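(* For every fixed integer $k\ge 3$ there exist a constant $c_k>0$ and an integer $n_0$ such that for every $n\ge n_0$ with $kn$ even, the number of distinct values of $\tau(G)$, as $G$ ranges over the connected $k$-regular simple graphs on $n$ vertices, is at least $2^{c_k n}$.
   Context: For a graph $G$, $\tau(G)$ denotes the number of spanning trees of $G$. *)

theory Defs
  imports Complex_Main "Graph_Theory.Digraph_Component"
begin

text \<open>
  A finite simple graph is a \<^const>\<open>pair_graph\<close>: a finite, loop-free, symmetric set of arcs, each edge
  being represented by its two opposite arcs.  In this representation the library predicates
  \<^const>\<open>forest\<close>, \<^const>\<open>tree\<close> and \<^const>\<open>spanning_tree\<close> are not the undirected notions, since
  the walk \<open>a, b, a\<close> along one edge counts as a \<^const>\<open>pre_digraph.cycle\<close>.  The cycles of the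
  undirected graph are exactly those of length at least 3.
\<close>

definition regular_graph :: "nat \<Rightarrow> 'a pair_pre_digraph \<Rightarrow> bool" where
  "regular_graph k G \<longleftrightarrow>
     pair_graph G \<and> (\<forall>v \<in> pverts G. out_degree (with_proj G) v = k)"

definition undirected_tree :: "'a pair_pre_digraph \<Rightarrow> bool" where
  "undirected_tree T \<longleftrightarrow>
     pair_graph T \<and> Digraph_Component.connected (with_proj T) \<and>
     \<not> (\<exists>p. pre_digraph.cycle (with_proj T) p \<and> 3 \<le> length p)"

definition num_spanning_trees :: "'a pair_pre_digraph \<Rightarrow> nat" where
  "num_spanning_trees G =
     card {T :: 'a pair_pre_digraph. undirected_tree T \<and> spanning (with_proj T) (with_proj G)}"

end

theory Submission
  imports Defs
begin

text \<open>
  For a graph with two terminals let \<open>T\<close> be its number of spanning trees and \<open>F\<close> its number of spanning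
  forests with two components that separate the terminals.  Parallel composition sends \<open>(T, F)\<close>,
  \<open>(T', F')\<close> to \<open>(T F' + F T', F F')\<close> and series composition to \<open>(T T', T F' + F T')\<close>, so the effective
  resistance \<open>F / T\<close> obeys the usual laws.  Let \<open>N\<close> be a connected \<open>k\<close>-regular circulant graph minus an
  edge, and \<open>P\<close> the same with a pendant edge at both ends.  Putting \<open>k - 2\<close> copies of \<open>P\<close> in parallel to
  a graph and a pendant edge at both ends, optionally followed by two more copies of \<open>N\<close> in
  series, defines two injective linear maps on \<open>(T, F)\<close> whose images are separated by the
  resistance.  Hence the \<open>2 ^ m\<close> words of \<open>m\<close> blocks, where a block is one of the two products of both
  maps, give distinct pairs from graphs of the same size.  Closing such a graph to a \<open>k\<close>-regular one
  in two ways with different resistances yields two tree counts which together determine \<open>(T, F)\<close>, so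
  at least \<open>2 ^ (m / 2)\<close> different tree counts occur.  The size of the innermost circulant is chosen
  to reach every admissible \<open>n\<close>.
\<close>

subsection \<open>Trees glued along one or two vertices\<close>

abbreviation link :: "'a \<Rightarrow> 'a \<Rightarrow> ('a \<times> 'a) set" where
  "link u v \<equiv> {(u, v), (v, u)}"

text \<open>
  Edge sets are symmetric relations; a tree on \<open>V\<close> is encoded as a connected one in which every edge is
  a bridge.
\<close>

definition stree :: "'a set \<Rightarrow> ('a \<times> 'a) set \<Rightarrow> bool" where
  "stree V A \<longleftrightarrow> sym A \<and> A \<subseteq> V \<times> V \<and> (\<forall>x\<in>V. \<forall>y\<in>V. (x, y) \<in> A\<^sup>*) \<and>
     (\<forall>x y. (x, y) \<in> A \<longrightarrow> (x, y) \<notin> (A - link x y)\<^sup>*)"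

text \<open>The spanning forests with two components that separate \<open>u\<close> from \<open>v\<close>.\<close>

definition sforest :: "'a set \<Rightarrow> ('a \<times> 'a) set \<Rightarrow> 'a \<Rightarrow> 'a \<Rightarrow> bool" where
  "sforest V A u v \<longleftrightarrow> sym A \<and> (u, v) \<notin> A \<and> stree V (A \<union> link u v)"

section \<open>Reachability in a union glued along two vertices\<close>

lemma sym_rtranclD: "sym A \<Longrightarrow> (x, y) \<in> A\<^sup>* \<Longrightarrow> (y, x) \<in> A\<^sup>*"
  by (meson sym_rtrancl symD)

lemma rtrancl_insert_refl: "(insert (v, v) A)\<^sup>* = A\<^sup>*"
proof -
  have "insert (v, v) A - Id = A - Id" by auto
  then show ?thesis by (metis rtrancl_r_diff_Id)
qed

text \<open>An excursion into \<open>V2\<close> enters and leaves through \<open>u\<close> or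
  \<open>v\<close>, so the virtual link in \<open>A'\<close> can replace it. While the path is
  inside \<open>V2\<close>, \<open>w\<close> remembers a gluing vertex from which the current point
  is reached in \<open>B\<close>.\<close>

lemma rtrancl_glueD:
  assumes A: "A \<subseteq> V1 \<times> V1" and B: "B \<subseteq> V2 \<times> V2" "sym B" and V: "V1 \<inter> V2 = {u, v}"
    and path: "(x, z) \<in> (A \<union> B)\<^sup>*" and x: "x \<in> V1"
  defines "A' \<equiv> A \<union> (if (u, v) \<in> B\<^sup>* then link u v else {})"
  shows "(z \<in> V1 \<longrightarrow> (x, z) \<in> A'\<^sup>*) \<and> (z \<in> V2 \<longrightarrow> (\<exists>w\<in>{u, v}. (x, w) \<in> A'\<^sup>* \<and> (w, z) \<in> B\<^sup>*))"
  using path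
proof (induction rule: rtrancl_induct)
  case base
  then show ?case using x V by blast
next
  case (step y z)
  show ?case
  proof (cases "(y, z) \<in> A")
    case True
    then have "y \<in> V1" "z \<in> V1" using A by auto
    then have "(x, z) \<in> A'\<^sup>*"
      using step.IH True by (auto simp: A'_def intro: rtrancl_into_rtrancl)
    then show ?thesis using \<open>z \<in> V1\<close> V by blast
  next
    case False
    then have yz: "(y, z) \<in> B" "y \<in> V2" "z \<in> V2" using step.hyps B by auto
    then obtain w where w: "w \<in> {u, v}" "(x, w) \<in> A'\<^sup>*" "(w, z) \<in> B\<^sup>*"
      using step.IH by (meson rtrancl_into_rtrancl)
    have "(x, z) \<in> A'\<^sup>*" if "z \<in> V1"
    proof (cases "z = w")
      case True
      then show ?thesis using w by simp
    next
      case False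
      \<comment> \<open>The path returns at the other gluing vertex, so \<open>B\<close> joins
        \<open>u\<close> to \<open>v\<close> and the virtual link is present.\<close>
      have "z \<in> {u, v}" using that yz V by blast
      then have wz: "(w, z) \<in> link u v" using w False by auto
      then have "(u, v) \<in> B\<^sup>*" using w sym_rtranclD[OF B(2)] by auto
      then have "(w, z) \<in> A'" using wz unfolding A'_def by auto
      then show ?thesis using w by (meson rtrancl_into_rtrancl)
    qed
    then show ?thesis using w by blast
  qed
qed

lemma rtrancl_glue_iff:
  assumes "A \<subseteq> V1 \<times> V1" "B \<subseteq> V2 \<times> V2" "sym B" "V1 \<inter> V2 = {u, v}" "x \<in> V1" "y \<in> V1"
  shows "(x, y) \<in> (A \<union> B)\<^sup>* \<longleftrightarrow> (x, y) \<in> (A \<union> (if (u, v) \<in> B\<^sup>* then link u v else {}))\<^sup>*"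
    (is "_ \<longleftrightarrow> _ \<in> ?A'\<^sup>*")
proof
  assume "(x, y) \<in> (A \<union> B)\<^sup>*"
  then show "(x, y) \<in> ?A'\<^sup>*" using rtrancl_glueD[OF assms(1-4) _ assms(5), of y] assms(6) by blast
next
  have "link u v \<subseteq> B\<^sup>*" if "(u, v) \<in> B\<^sup>*"
    using that sym_rtranclD[OF assms(3)] by auto
  then have "?A' \<subseteq> (A \<union> B)\<^sup>*"
    using rtrancl_mono[of B "A \<union> B"] by auto
  then have "?A'\<^sup>* \<subseteq> (A \<union> B)\<^sup>*"
    using rtrancl_subset_rtrancl by blast
  then show "(x, y) \<in> ?A'\<^sup>* \<Longrightarrow> (x, y) \<in> (A \<union> B)\<^sup>*" by blast
qed

lemma rtrancl_link_exchange:
  assumes "sym A" "(x, y) \<in> (A \<union> link p q)\<^sup>*" "(x, y) \<notin> A\<^sup>*"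
  shows "((x, p) \<in> A\<^sup>* \<and> (q, y) \<in> A\<^sup>*) \<or> ((x, q) \<in> A\<^sup>* \<and> (p, y) \<in> A\<^sup>*)"
proof -
  have "(x, y) \<in> A\<^sup>* \<or> ((x, p) \<in> A\<^sup>* \<and> (q, y) \<in> A\<^sup>*) \<or> ((x, q) \<in> A\<^sup>* \<and> (p, y) \<in> A\<^sup>*)"
    using assms(2)
  proof (induction rule: rtrancl_induct)
    case base
    then show ?case by simp
  next
    case (step y z)
    then consider "(y, z) \<in> A" | "y = p" "z = q" | "y = q" "z = p" by auto
    then show ?case
    proof cases
      case 1
      then show ?thesis using step.IH by (meson rtrancl_into_rtrancl)
    next
      case 2
      then show ?thesis using step.IH sym_rtranclD[OF assms(1)] by (meson rtrancl.rtrancl_refl rtrancl_trans)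
    next
      case 3
      then show ?thesis using step.IH sym_rtranclD[OF assms(1)] by (meson rtrancl.rtrancl_refl rtrancl_trans)
    qed
  qed
  then show ?thesis using assms(3) by blast
qed

text \<open>Linking two vertices that are already connected closes a cycle. Deleting arcs one edge
  at a time, the first deletion that separates \<open>u\<close> from \<open>v\<close> exhibits an
  arc whose ends are joined through the link instead.\<close>

lemma closing_link_spans_arc:
  assumes "finite A" "sym A" "(u, v) \<in> A\<^sup>*" "u \<noteq> v"
  shows "\<exists>x y. (x, y) \<in> A \<and> (x, y) \<in> ((A - link x y) \<union> link u v)\<^sup>*"
  using assms
proof (induction A rule: finite_psubset_induct)
  case (psubset A)
  have "A \<noteq> {}" using psubset.prems by auto
  then obtain x y where xy: "(x, y) \<in> A" by auto
  let ?A = "A - link x y"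
  have symA: "sym ?A" using psubset.prems(1) by (auto simp: sym_def)
  show ?case
  proof (cases "(u, v) \<in> ?A\<^sup>*")
    case True
    then obtain p q where pq: "(p, q) \<in> ?A" "(p, q) \<in> ((?A - link p q) \<union> link u v)\<^sup>*"
      using psubset.IH[of ?A] xy symA psubset.prems by blast
    have "((?A - link p q) \<union> link u v)\<^sup>* \<subseteq> ((A - link p q) \<union> link u v)\<^sup>*"
      by (rule rtrancl_mono) auto
    then show ?thesis using pq by blast
  next
    case False
    have "A = ?A \<union> link x y" using xy psubset.prems(1) by (auto simp: sym_def)
    then have "(u, v) \<in> (?A \<union> link x y)\<^sup>*" using psubset.prems(2) by simp
    from rtrancl_link_exchange[OF symA this False]
    have ex: "((u, x) \<in> ?A\<^sup>* \<and> (y, v) \<in> ?A\<^sup>*) \<or> ((u, y) \<in> ?A\<^sup>* \<and> (x, v) \<in> ?A\<^sup>*)" .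
    have uv: "(u, v) \<in> (?A \<union> link u v)\<^sup>*" "(v, u) \<in> (?A \<union> link u v)\<^sup>*" by auto
    have mono: "p \<in> ?A\<^sup>* \<Longrightarrow> p \<in> (?A \<union> link u v)\<^sup>*" for p
      using rtrancl_mono[of ?A "?A \<union> link u v"] by blast
    have "(x, y) \<in> (?A \<union> link u v)\<^sup>*"
      using ex uv mono sym_rtranclD[OF symA] by (meson rtrancl_trans)
    then show ?thesis using xy by blast
  qed
qed

text \<open>Brings \<open>sforest\<close> into the shape of the conditions in
  \<open>stree_glue_aux\<close>. The bridge condition on the added link becomes the separation of
  \<open>u\<close> from \<open>v\<close> in \<open>A\<close>.\<close>

lemma sforest_iff:
  assumes "sym A" "A \<subseteq> V \<times> V" "u \<in> V" "v \<in> V"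
  shows "sforest V A u v \<longleftrightarrow> (u, v) \<notin> A\<^sup>* \<and> (\<forall>x\<in>V. \<forall>y\<in>V. (x, y) \<in> (A \<union> link u v)\<^sup>*) \<and>
     (\<forall>x y. (x, y) \<in> A \<longrightarrow> (x, y) \<notin> (A - link x y \<union> link u v)\<^sup>*)"
proof (cases "(u, v) \<in> A")
  case True
  then show ?thesis by (auto simp: sforest_def)
next
  case False
  then have vu: "(v, u) \<notin> A" using assms(1) by (auto simp: sym_def)
  have 1: "A \<union> link u v - link u v = A" "A \<union> link u v - link v u = A" using False vu by auto
  have 2: "A \<union> link u v - link x y = A - link x y \<union> link u v" if "(x, y) \<in> A" for x y
    using that False vu by auto
  have 3: "(v, u) \<in> A\<^sup>* \<longleftrightarrow> (u, v) \<in> A\<^sup>*" using sym_rtranclD[OF assms(1)] by blast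
  have "sym (A \<union> link u v)" using assms(1) by (auto simp: sym_def)
  moreover have "(\<forall>x y. (x, y) \<in> A \<union> link u v \<longrightarrow> (x, y) \<notin> (A \<union> link u v - link x y)\<^sup>*) \<longleftrightarrow>
    (\<forall>x y. (x, y) \<in> A \<longrightarrow> (x, y) \<notin> (A - link x y \<union> link u v)\<^sup>*) \<and> (u, v) \<notin> A\<^sup>*"
    (is "?L \<longleftrightarrow> ?R")
  proof
    assume L: ?L
    have "(u, v) \<notin> (A \<union> link u v - link u v)\<^sup>*" using L by blast
    moreover have "(x, y) \<notin> (A - link x y \<union> link u v)\<^sup>*" if "(x, y) \<in> A" for x y
      using L 2[OF that] that by (metis Un_iff)
    ultimately show ?R unfolding 1 by blast
  next
    assume R: ?R
    show ?L
    proof (intro allI impI)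
      fix x y assume "(x, y) \<in> A \<union> link u v"
      then consider "(x, y) \<in> A" | "x = u" "y = v" | "x = v" "y = u" by auto
      then show "(x, y) \<notin> (A \<union> link u v - link x y)\<^sup>*"
      proof cases
        case 1 then show ?thesis using R 2 by metis
      next
        case 2 then show ?thesis using R 1 by metis
      next
        case c: 3 then show ?thesis using R 1 3 by metis
      qed
    qed
  qed
  ultimately show ?thesis unfolding sforest_def stree_def using False assms by auto
qed

text \<open>Seen from \<open>V1\<close>, the edges of \<open>B\<close> matter only through whether they join \<open>u\<close> to \<open>v\<close>.\<close>

lemma stree_glue_aux:
  assumes A: "A \<subseteq> V1 \<times> V1" "sym A" and B: "B \<subseteq> V2 \<times> V2" "sym B"
    and V: "V1 \<inter> V2 = {u, v}" and disj: "A \<inter> B = {}"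
  defines "X \<equiv> \<lambda>C. if (u, v) \<in> C\<^sup>* then link u v else {}"
  shows "stree (V1 \<union> V2) (A \<union> B) \<longleftrightarrow>
    (\<forall>x\<in>V1. \<forall>y\<in>V1. (x, y) \<in> (A \<union> X B)\<^sup>*) \<and> (\<forall>x\<in>V2. \<forall>y\<in>V2. (x, y) \<in> (B \<union> X A)\<^sup>*) \<and>
    (\<forall>x y. (x, y) \<in> A \<longrightarrow> (x, y) \<notin> (A - link x y \<union> X B)\<^sup>*) \<and>
    (\<forall>x y. (x, y) \<in> B \<longrightarrow> (x, y) \<notin> (B - link x y \<union> X A)\<^sup>*)"
    (is "?tree \<longleftrightarrow> ?c1 \<and> ?c2 \<and> ?b1 \<and> ?b2")
proof -
  have V': "V2 \<inter> V1 = {u, v}" using V by blast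
  have g1: "(x, y) \<in> (A' \<union> B)\<^sup>* \<longleftrightarrow> (x, y) \<in> (A' \<union> X B)\<^sup>*" if "A' \<subseteq> A" "x \<in> V1" "y \<in> V1" for A' x y
    unfolding X_def using that A by (intro rtrancl_glue_iff[OF _ B V]) auto
  have g2: "(x, y) \<in> (A \<union> B')\<^sup>* \<longleftrightarrow> (x, y) \<in> (B' \<union> X A)\<^sup>*" if "B' \<subseteq> B" "x \<in> V2" "y \<in> V2" for B' x y
    unfolding X_def Un_commute[of A] using that B by (intro rtrancl_glue_iff[OF _ A V']) auto
  have c: "(\<forall>x\<in>V1 \<union> V2. \<forall>y\<in>V1 \<union> V2. (x, y) \<in> (A \<union> B)\<^sup>*) \<longleftrightarrow> ?c1 \<and> ?c2"
  proof
    assume "\<forall>x\<in>V1 \<union> V2. \<forall>y\<in>V1 \<union> V2. (x, y) \<in> (A \<union> B)\<^sup>*"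
    then show "?c1 \<and> ?c2" using g1[of A] g2[of B] by blast
  next
    assume "?c1 \<and> ?c2"
    then have "\<forall>x\<in>V1. \<forall>y\<in>V1. (x, y) \<in> (A \<union> B)\<^sup>*" "\<forall>x\<in>V2. \<forall>y\<in>V2. (x, y) \<in> (A \<union> B)\<^sup>*"
      using g1[of A] g2[of B] by blast+
    moreover have "u \<in> V1" "u \<in> V2" using V by auto
    ultimately have "(x, u) \<in> (A \<union> B)\<^sup>*" "(u, x) \<in> (A \<union> B)\<^sup>*" if "x \<in> V1 \<union> V2" for x
      using that by blast+
    then show "\<forall>x\<in>V1 \<union> V2. \<forall>y\<in>V1 \<union> V2. (x, y) \<in> (A \<union> B)\<^sup>*"
      by (blast intro: rtrancl_trans)
  qed
  have d1: "A \<union> B - link x y = A - link x y \<union> B" if "(x, y) \<in> A" for x y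
    using that disj A(2) by (auto simp: sym_def)
  have d2: "A \<union> B - link x y = A \<union> (B - link x y)" if "(x, y) \<in> B" for x y
    using that disj B(2) by (auto simp: sym_def)
  have b1: "(x, y) \<in> (A \<union> B - link x y)\<^sup>* \<longleftrightarrow> (x, y) \<in> (A - link x y \<union> X B)\<^sup>*" if "(x, y) \<in> A" for x y
    unfolding d1[OF that] using that A by (intro g1) auto
  have b2: "(x, y) \<in> (A \<union> B - link x y)\<^sup>* \<longleftrightarrow> (x, y) \<in> (B - link x y \<union> X A)\<^sup>*" if "(x, y) \<in> B" for x y
    unfolding d2[OF that] using that B by (intro g2) auto
  have b: "(\<forall>x y. (x, y) \<in> A \<union> B \<longrightarrow> (x, y) \<notin> (A \<union> B - link x y)\<^sup>*) \<longleftrightarrow> ?b1 \<and> ?b2"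
    using b1 b2 by (meson Un_iff)
  have s: "sym (A \<union> B)" "A \<union> B \<subseteq> (V1 \<union> V2) \<times> (V1 \<union> V2)"
    using A B by (auto simp: sym_Un)
  show ?thesis unfolding stree_def c b using s by blast
qed

text \<open>The cases are which sides join \<open>u\<close> to \<open>v\<close>. If both do,
  \<open>closing_link_spans_arc\<close> gives an arc that is no bridge; if neither does,
  connectedness fails. If exactly one does, the other side sees a virtual link and must be a
  separating forest.\<close>

theorem stree_two_sum:
  assumes A: "A \<subseteq> V1 \<times> V1" "sym A" "finite A" and B: "B \<subseteq> V2 \<times> V2" "sym B" "finite B"
    and V: "V1 \<inter> V2 = {u, v}" and disj: "A \<inter> B = {}" and uv: "u \<noteq> v"
  shows "stree (V1 \<union> V2) (A \<union> B) \<longleftrightarrow>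
    stree V1 A \<and> sforest V2 B u v \<or> sforest V1 A u v \<and> stree V2 B"
proof -
  note aux = stree_glue_aux[OF A(1,2) B(1,2) V disj]
  have mem: "u \<in> V1" "v \<in> V1" "u \<in> V2" "v \<in> V2" using V by auto
  note fA = sforest_iff[OF A(2,1) mem(1,2)] and fB = sforest_iff[OF B(2,1) mem(3,4)]
  have tA: "(u, v) \<in> A\<^sup>*" if "stree V1 A" using that mem by (simp add: stree_def)
  have tB: "(u, v) \<in> B\<^sup>*" if "stree V2 B" using that mem by (simp add: stree_def)
  consider "(u, v) \<in> A\<^sup>*" "(u, v) \<in> B\<^sup>*" | "(u, v) \<notin> A\<^sup>*" "(u, v) \<notin> B\<^sup>*"
    | "(u, v) \<in> A\<^sup>*" "(u, v) \<notin> B\<^sup>*" | "(u, v) \<notin> A\<^sup>*" "(u, v) \<in> B\<^sup>*" by blast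
  then show ?thesis
  proof cases
    case 1
    then show ?thesis unfolding aux fA fB
      using closing_link_spans_arc[OF A(3,2) _ uv] by simp
  next
    case 2
    then show ?thesis unfolding aux fA fB using tA tB mem by auto
  next
    case 3
    then show ?thesis unfolding aux fA fB using tB A B by (auto simp: stree_def)
  next
    case 4
    then show ?thesis unfolding aux fA fB using tA A B by (auto simp: stree_def)
  qed
qed

theorem stree_one_sum:
  assumes A: "A \<subseteq> V1 \<times> V1" "sym A" and B: "B \<subseteq> V2 \<times> V2" "sym B"
    and V: "V1 \<inter> V2 = {v}" and disj: "A \<inter> B = {}"
  shows "stree (V1 \<union> V2) (A \<union> B) \<longleftrightarrow> stree V1 A \<and> stree V2 B"
proof -
  \<comment> \<open>Gluing at one vertex is the case \<open>u = v\<close>: the virtual link is a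
    loop and leaves reachability unchanged.\<close>
  have V': "V1 \<inter> V2 = {v, v}" using V by simp
  show ?thesis unfolding stree_glue_aux[OF A B V' disj]
    using A B by (auto simp: stree_def rtrancl_insert_refl)
qed

subsection \<open>Counting trees in series and parallel compositions\<close>

definition ntrees :: "'a set \<Rightarrow> ('a \<times> 'a) set \<Rightarrow> nat" where
  "ntrees V E = card {A. A \<subseteq> E \<and> stree V A}"

definition nforests :: "'a set \<Rightarrow> ('a \<times> 'a) set \<Rightarrow> 'a \<Rightarrow> 'a \<Rightarrow> nat" where
  "nforests V E u v = card {A. A \<subseteq> E \<and> sforest V A u v}"

lemma stree_link: "u \<noteq> v \<Longrightarrow> stree {u, v} (link u v)"
  by (auto simp: stree_def sym_def)

lemma stree_two_links:
  assumes "u \<noteq> v" "u \<noteq> w" "v \<noteq> w"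
  shows "stree {u, v, w} (link u w \<union> link u v)"
proof -
  have "stree ({u, w} \<union> {u, v}) (link u w \<union> link u v)"
    using assms by (subst stree_one_sum[where v = u]) (auto simp: stree_link sym_def)
  moreover have "{u, w} \<union> {u, v} = {u, v, w}" by auto
  ultimately show ?thesis by simp
qed

lemma sforest_parallel:
  assumes A: "A \<subseteq> V1 \<times> V1" "sym A" "finite A" and B: "B \<subseteq> V2 \<times> V2" "sym B" "finite B"
    and V: "V1 \<inter> V2 = {u, v}" and disj: "A \<inter> B = {}" and uv: "u \<noteq> v"
    and nadj: "(u, v) \<notin> A" "(u, v) \<notin> B"
  shows "sforest (V1 \<union> V2) (A \<union> B) u v \<longleftrightarrow> sforest V1 A u v \<and> sforest V2 B u v"
proof -
  have nadj': "(v, u) \<notin> A" "(v, u) \<notin> B" using nadj A B by (auto simp: sym_def)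
  have "sforest (V1 \<union> V2) (A \<union> B) u v \<longleftrightarrow> stree (V1 \<union> V2) (A \<union> (B \<union> link u v))"
    using nadj A(2) B(2) by (simp add: sforest_def Un_assoc sym_Un)
  also have "\<dots> \<longleftrightarrow> stree V1 A \<and> sforest V2 (B \<union> link u v) u v \<or>
      sforest V1 A u v \<and> stree V2 (B \<union> link u v)"
    using A B V disj uv nadj nadj' by (intro stree_two_sum) (auto simp: sym_def)
  \<comment> \<open>The first alternative is void, since \<open>B \<union> link u v\<close> contains
    the arc \<open>(u, v)\<close>.\<close>
  also have "\<dots> \<longleftrightarrow> sforest V1 A u v \<and> sforest V2 B u v"
    using B nadj by (simp add: sforest_def)
  finally show ?thesis .
qed

text \<open>The link between \<open>u\<close> and \<open>w\<close> is counted with \<open>B\<close>,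
  whose vertex set gains \<open>u\<close>. The two sides then meet in \<open>u\<close> and
  \<open>v\<close>, and \<open>stree_two_sum\<close> applies.\<close>

lemma sforest_series:
  assumes A: "A \<subseteq> V1 \<times> V1" "sym A" "finite A" and B: "B \<subseteq> V2 \<times> V2" "sym B" "finite B"
    and V: "V1 \<inter> V2 = {v}" and disj: "A \<inter> B = {}"
    and u: "u \<in> V1" "u \<noteq> v" and w: "w \<in> V2" "w \<noteq> v"
  shows "sforest (V1 \<union> V2) (A \<union> B) u w \<longleftrightarrow>
    stree V1 A \<and> sforest V2 B v w \<or> sforest V1 A u v \<and> stree V2 B"
proof -
  have out: "u \<notin> V2" "w \<notin> V1" "u \<noteq> w" "v \<in> V1" "v \<in> V2" using u w V by auto
  have nadj: "(x, u) \<notin> B" "(u, x) \<notin> B" "(x, w) \<notin> A" "(w, x) \<notin> A" for x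
    using out A(1) B(1) by auto
  have "sforest (V1 \<union> V2) (A \<union> B) u w \<longleftrightarrow> stree (V1 \<union> insert u V2) (A \<union> (B \<union> link u w))"
    using nadj A(2) B(2) u by (simp add: sforest_def Un_assoc sym_Un insert_absorb)
  also have "\<dots> \<longleftrightarrow> stree V1 A \<and> sforest (insert u V2) (B \<union> link u w) u v \<or>
      sforest V1 A u v \<and> stree (insert u V2) (B \<union> link u w)"
    using A B V disj u w out nadj by (intro stree_two_sum) (auto simp: sym_def)
  \<comment> \<open>Here \<open>u\<close> hangs from \<open>w\<close> by a pendant edge, which can
    be cut off.\<close>
  also have "stree (insert u V2) (B \<union> link u w) \<longleftrightarrow> stree V2 B"
  proof -
    have "stree (V2 \<union> {u, w}) (B \<union> link u w) \<longleftrightarrow> stree V2 B \<and> stree {u, w} (link u w)"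
      using B w out nadj by (intro stree_one_sum[where v = w]) (auto simp: sym_def)
    moreover have "V2 \<union> {u, w} = insert u V2" using w by auto
    ultimately show ?thesis using stree_link[OF out(3)] by simp
  qed
  \<comment> \<open>With the link to \<open>v\<close> added, \<open>u\<close> is the midpoint of a
    two-link path glued to \<open>B\<close> at \<open>v\<close> and \<open>w\<close>. That path is a
    tree and does not separate its ends, so one alternative survives.\<close>
  also have "sforest (insert u V2) (B \<union> link u w) u v \<longleftrightarrow> sforest V2 B v w"
  proof -
    have "sforest (insert u V2) (B \<union> link u w) u v \<longleftrightarrow>
        stree (V2 \<union> {u, v, w}) (B \<union> (link u w \<union> link u v))"
      using B(2) nadj w out by (auto simp: sforest_def sym_def insert_absorb insert_commute Un_assoc)
    also have "\<dots> \<longleftrightarrow> stree V2 B \<and> sforest {u, v, w} (link u w \<union> link u v) v w \<or>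
        sforest V2 B v w \<and> stree {u, v, w} (link u w \<union> link u v)"
      using B u w out nadj by (intro stree_two_sum) (auto simp: sym_def)
    also have "sforest {u, v, w} (link u w \<union> link u v) v w \<longleftrightarrow> False"
    proof -
      have "(v, w) \<in> (link u w \<union> link u v)\<^sup>*"
        by (rule rtrancl_trans[of v u]) auto
      then show ?thesis by (subst sforest_iff) (auto simp: sym_def)
    qed
    also have "stree {u, v, w} (link u w \<union> link u v) \<longleftrightarrow> True"
      using stree_two_links[of u v w] u w out by auto
    finally show ?thesis by simp
  qed
  finally show ?thesis .
qed

lemma card_subsets_Un_disjoint:
  assumes "E1 \<inter> E2 = {}"
  shows "card {A. A \<subseteq> E1 \<union> E2 \<and> P A} = card {(A, B). A \<subseteq> E1 \<and> B \<subseteq> E2 \<and> P (A \<union> B)}"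
proof -
  have "bij_betw (\<lambda>A. (A \<inter> E1, A \<inter> E2)) {A. A \<subseteq> E1 \<union> E2 \<and> P A}
      {(A, B). A \<subseteq> E1 \<and> B \<subseteq> E2 \<and> P (A \<union> B)}"
  proof (rule bij_betw_byWitness[where f' = "\<lambda>(A, B). A \<union> B"])
    have "A \<inter> E1 \<union> A \<inter> E2 = A" if "A \<subseteq> E1 \<union> E2" for A using that by auto
    then show "(\<lambda>A. (A \<inter> E1, A \<inter> E2)) ` {A. A \<subseteq> E1 \<union> E2 \<and> P A} \<subseteq>
        {(A, B). A \<subseteq> E1 \<and> B \<subseteq> E2 \<and> P (A \<union> B)}" by auto
  qed (use assms in auto)
  then show ?thesis by (rule bij_betw_same_card)
qed

lemma sym_Un_disjointD:
  assumes "sym (A \<union> B)" "A \<subseteq> E1" "B \<subseteq> E2" "E1 \<inter> E2 = {}" "sym E1" "sym E2"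
  shows "sym A \<and> sym B"
  using assms unfolding sym_def by blast

lemma card_exclusive_product:
  assumes "finite E1" "finite E2" "\<And>A. P1 A \<Longrightarrow> \<not> Q1 A"
  shows "card {(A, B). A \<subseteq> E1 \<and> B \<subseteq> E2 \<and> (P1 A \<and> Q2 B \<or> Q1 A \<and> P2 B)} =
    card {A. A \<subseteq> E1 \<and> P1 A} * card {B. B \<subseteq> E2 \<and> Q2 B} +
    card {A. A \<subseteq> E1 \<and> Q1 A} * card {B. B \<subseteq> E2 \<and> P2 B}"
proof -
  have "{(A, B). A \<subseteq> E1 \<and> B \<subseteq> E2 \<and> (P1 A \<and> Q2 B \<or> Q1 A \<and> P2 B)} =
    {A. A \<subseteq> E1 \<and> P1 A} \<times> {B. B \<subseteq> E2 \<and> Q2 B} \<union> {A. A \<subseteq> E1 \<and> Q1 A} \<times> {B. B \<subseteq> E2 \<and> P2 B}"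
    by auto
  moreover have "{A. A \<subseteq> E1 \<and> P1 A} \<times> {B. B \<subseteq> E2 \<and> Q2 B} \<inter>
      ({A. A \<subseteq> E1 \<and> Q1 A} \<times> {B. B \<subseteq> E2 \<and> P2 B}) = {}"
    using assms(3) by auto
  ultimately show ?thesis
    using assms(1,2) by (simp add: card_Un_disjoint card_cartesian_product)
qed

lemma stree_not_sforest:
  assumes "u \<in> V" "v \<in> V" "stree V A"
  shows "\<not> sforest V A u v"
proof -
  have "sym A" "A \<subseteq> V \<times> V" "(u, v) \<in> A\<^sup>*" using assms by (auto simp: stree_def)
  then show ?thesis using assms by (subst sforest_iff) auto
qed

lemma stree_imp_sym: "stree V A \<Longrightarrow> sym A"
  by (simp add: stree_def)

lemma sforest_imp_sym: "sforest V A u v \<Longrightarrow> sym A"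
  by (simp add: sforest_def)

context
  fixes V1 V2 :: "'a set" and E1 E2 :: "('a \<times> 'a) set"
  assumes E1: "E1 \<subseteq> V1 \<times> V1" "sym E1" "finite E1" and E2: "E2 \<subseteq> V2 \<times> V2" "sym E2" "finite E2"
    and disj: "E1 \<inter> E2 = {}"
begin

lemma ntrees_parallel:
  assumes V: "V1 \<inter> V2 = {u, v}" and uv: "u \<noteq> v"
  shows "ntrees (V1 \<union> V2) (E1 \<union> E2) =
    ntrees V1 E1 * nforests V2 E2 u v + nforests V1 E1 u v * ntrees V2 E2"
proof -
  have "stree (V1 \<union> V2) (A \<union> B) \<longleftrightarrow>
      stree V1 A \<and> sforest V2 B u v \<or> sforest V1 A u v \<and> stree V2 B"
    if AB: "A \<subseteq> E1" "B \<subseteq> E2" for A B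
  proof (cases "sym A \<and> sym B")
    case True
    then have sub: "A \<subseteq> V1 \<times> V1" "sym A" "finite A" "B \<subseteq> V2 \<times> V2" "sym B" "finite B" "A \<inter> B = {}"
      using AB E1 E2 disj finite_subset[OF AB(1) E1(3)] finite_subset[OF AB(2) E2(3)] by auto
    then show ?thesis
      using sub V uv by (intro stree_two_sum)
  next
    \<comment> \<open>An asymmetric choice of arcs satisfies neither side of the
      equivalence.\<close>
    case False
    then show ?thesis using sym_Un_disjointD[OF _ AB disj E1(2) E2(2)]
      by (auto simp: stree_def sforest_def)
  qed
  then have eq: "{(A, B). A \<subseteq> E1 \<and> B \<subseteq> E2 \<and> stree (V1 \<union> V2) (A \<union> B)} =
      {(A, B). A \<subseteq> E1 \<and> B \<subseteq> E2 \<and>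
        (stree V1 A \<and> sforest V2 B u v \<or> sforest V1 A u v \<and> stree V2 B)}"
    by auto
  have "u \<in> V1" "v \<in> V1" using V by auto
  then show ?thesis
    unfolding ntrees_def nforests_def card_subsets_Un_disjoint[OF disj] eq
    by (intro card_exclusive_product E1 E2 stree_not_sforest)
qed

lemma nforests_parallel:
  assumes V: "V1 \<inter> V2 = {u, v}" and uv: "u \<noteq> v" and nadj: "(u, v) \<notin> E1" "(u, v) \<notin> E2"
  shows "nforests (V1 \<union> V2) (E1 \<union> E2) u v = nforests V1 E1 u v * nforests V2 E2 u v"
proof -
  have "sforest (V1 \<union> V2) (A \<union> B) u v \<longleftrightarrow> sforest V1 A u v \<and> sforest V2 B u v"
    if AB: "A \<subseteq> E1" "B \<subseteq> E2" for A B
  proof (cases "sym A \<and> sym B")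
    case True
    then have sub: "A \<subseteq> V1 \<times> V1" "sym A" "finite A" "B \<subseteq> V2 \<times> V2" "sym B" "finite B" "A \<inter> B = {}"
      using AB E1 E2 disj finite_subset[OF AB(1) E1(3)] finite_subset[OF AB(2) E2(3)] by auto
    then show ?thesis
      using sub V uv nadj AB by (intro sforest_parallel) auto
  next
    case False
    then show ?thesis using sym_Un_disjointD[OF _ AB disj E1(2) E2(2)]
      by (auto simp: sforest_def)
  qed
  then have eq: "{(A, B). A \<subseteq> E1 \<and> B \<subseteq> E2 \<and> sforest (V1 \<union> V2) (A \<union> B) u v} =
      {A. A \<subseteq> E1 \<and> sforest V1 A u v} \<times> {B. B \<subseteq> E2 \<and> sforest V2 B u v}"
    by auto
  show ?thesis
    unfolding nforests_def card_subsets_Un_disjoint[OF disj] eq by (rule card_cartesian_product)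
qed

lemma ntrees_series:
  assumes V: "V1 \<inter> V2 = {v}"
  shows "ntrees (V1 \<union> V2) (E1 \<union> E2) = ntrees V1 E1 * ntrees V2 E2"
proof -
  have "stree (V1 \<union> V2) (A \<union> B) \<longleftrightarrow> stree V1 A \<and> stree V2 B"
    if AB: "A \<subseteq> E1" "B \<subseteq> E2" for A B
  proof (cases "sym A \<and> sym B")
    case True
    then show ?thesis
      using that E1 E2 disj V by (intro stree_one_sum) auto
  next
    case False
    then show ?thesis using sym_Un_disjointD[OF _ AB disj E1(2) E2(2)]
      by (auto simp: stree_def)
  qed
  then have eq: "{(A, B). A \<subseteq> E1 \<and> B \<subseteq> E2 \<and> stree (V1 \<union> V2) (A \<union> B)} =
      {A. A \<subseteq> E1 \<and> stree V1 A} \<times> {B. B \<subseteq> E2 \<and> stree V2 B}"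
    by auto
  show ?thesis
    unfolding ntrees_def card_subsets_Un_disjoint[OF disj] eq by (rule card_cartesian_product)
qed

lemma nforests_series:
  assumes V: "V1 \<inter> V2 = {v}" and u: "u \<in> V1" "u \<noteq> v" and w: "w \<in> V2" "w \<noteq> v"
  shows "nforests (V1 \<union> V2) (E1 \<union> E2) u w =
    ntrees V1 E1 * nforests V2 E2 v w + nforests V1 E1 u v * ntrees V2 E2"
proof -
  have "sforest (V1 \<union> V2) (A \<union> B) u w \<longleftrightarrow>
      stree V1 A \<and> sforest V2 B v w \<or> sforest V1 A u v \<and> stree V2 B"
    if AB: "A \<subseteq> E1" "B \<subseteq> E2" for A B
  proof (cases "sym A \<and> sym B")
    case True
    then have sub: "A \<subseteq> V1 \<times> V1" "sym A" "finite A" "B \<subseteq> V2 \<times> V2" "sym B" "finite B" "A \<inter> B = {}"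
      using AB E1 E2 disj finite_subset[OF AB(1) E1(3)] finite_subset[OF AB(2) E2(3)] by auto
    then show ?thesis
      using sub V u w by (intro sforest_series)
  next
    case False
    then show ?thesis using sym_Un_disjointD[OF _ AB disj E1(2) E2(2)]
      unfolding sforest_def[of "V1 \<union> V2"] by (auto simp: stree_imp_sym sforest_imp_sym)
  qed
  then have eq: "{(A, B). A \<subseteq> E1 \<and> B \<subseteq> E2 \<and> sforest (V1 \<union> V2) (A \<union> B) u w} =
      {(A, B). A \<subseteq> E1 \<and> B \<subseteq> E2 \<and>
        (stree V1 A \<and> sforest V2 B v w \<or> sforest V1 A u v \<and> stree V2 B)}"
    by auto
  have "v \<in> V1" using V by auto
  with u show ?thesis
    unfolding ntrees_def nforests_def card_subsets_Un_disjoint[OF disj] eq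
    by (intro card_exclusive_product E1 E2 stree_not_sforest)
qed

end

subsection \<open>Relabelling\<close>

lemma map_prod_rtrancl:
  "(x, y) \<in> A\<^sup>* \<Longrightarrow> (f x, f y) \<in> (map_prod f f ` A)\<^sup>*"
  by (induction rule: rtrancl_induct) (auto intro: rtrancl_into_rtrancl)

lemma map_prod_inv_into:
  assumes "inj_on f V" "A \<subseteq> V \<times> V"
  shows "map_prod (inv_into V f) (inv_into V f) ` map_prod f f ` A = A"
proof -
  have "map_prod (inv_into V f) (inv_into V f) (map_prod f f p) = p" if "p \<in> A" for p
    using that assms by auto
  then show ?thesis by (force simp: image_image)
qed

lemma rtrancl_map_prod_iff:
  assumes "inj_on f V" "A \<subseteq> V \<times> V" "x \<in> V" "y \<in> V"
  shows "(f x, f y) \<in> (map_prod f f ` A)\<^sup>* \<longleftrightarrow> (x, y) \<in> A\<^sup>*"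
proof
  assume "(f x, f y) \<in> (map_prod f f ` A)\<^sup>*"
  from map_prod_rtrancl[OF this, of "inv_into V f"] show "(x, y) \<in> A\<^sup>*"
    using assms by (simp add: map_prod_inv_into)
qed (rule map_prod_rtrancl)

lemma stree_map_prod:
  assumes "inj_on f V" "A \<subseteq> V \<times> V" "stree V A"
  shows "stree (f ` V) (map_prod f f ` A)"
proof -
  let ?m = "map_prod f f"
  have inj: "inj_on ?m (V \<times> V)" using assms(1) by (rule map_prod_inj_on) (rule assms(1))
  have "sym (?m ` A)" using assms(3) by (auto simp: stree_def sym_def)
  moreover have "?m ` A \<subseteq> f ` V \<times> f ` V" using assms(2) by auto
  moreover have "\<forall>x\<in>f ` V. \<forall>y\<in>f ` V. (x, y) \<in> (?m ` A)\<^sup>*"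
    using assms(3) by (auto simp: stree_def intro: map_prod_rtrancl)
  moreover have "(a, b) \<notin> (?m ` A - link a b)\<^sup>*" if "(a, b) \<in> ?m ` A" for a b
  proof -
    from that obtain x y where xy: "(x, y) \<in> A" "a = f x" "b = f y" by auto
    then have V: "x \<in> V" "y \<in> V" using assms(2) by auto
    have "?m ` (A - link x y) = ?m ` A - ?m ` link x y"
      using assms(2) V by (intro inj_on_image_set_diff[OF inj]) auto
    also have "?m ` link x y = link a b" using xy by auto
    finally have eq: "?m ` A - link a b = ?m ` (A - link x y)" by simp
    have "(x, y) \<notin> (A - link x y)\<^sup>*" using assms(3) xy by (auto simp: stree_def)
    then have "(f x, f y) \<notin> (?m ` (A - link x y))\<^sup>*"
      using rtrancl_map_prod_iff[OF assms(1) _ V, of "A - link x y"] assms(2) by blast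
    then show ?thesis unfolding eq by (simp add: xy)
  qed
  ultimately show ?thesis unfolding stree_def by blast
qed

lemma stree_map_prod_iff:
  assumes "inj_on f V" "A \<subseteq> V \<times> V"
  shows "stree (f ` V) (map_prod f f ` A) \<longleftrightarrow> stree V A"
proof
  assume "stree (f ` V) (map_prod f f ` A)"
  then have "stree (inv_into V f ` f ` V) (map_prod (inv_into V f) (inv_into V f) ` map_prod f f ` A)"
    using assms(2) by (intro stree_map_prod[OF inj_on_inv_into]) auto
  then show "stree V A" using assms(1) by (simp add: map_prod_inv_into[OF assms] inv_into_image_cancel)
qed (rule stree_map_prod[OF assms])

lemma card_subsets_image:
  assumes "inj_on g E" "\<And>A. A \<subseteq> E \<Longrightarrow> P (g ` A) \<longleftrightarrow> Q A"
  shows "card {A. A \<subseteq> g ` E \<and> P A} = card {A. A \<subseteq> E \<and> Q A}"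
proof -
  have "{A. A \<subseteq> g ` E \<and> P A} = (`) g ` {A. A \<subseteq> E \<and> Q A}"
    using assms(2) by (auto simp: subset_image_iff)
  moreover have "inj_on ((`) g) {A. A \<subseteq> E \<and> Q A}"
    using inj_on_image_Pow[OF assms(1)] by (rule inj_on_subset) auto
  ultimately show ?thesis by (simp add: card_image)
qed

lemma ntrees_map_prod:
  assumes "inj_on f V" "E \<subseteq> V \<times> V"
  shows "ntrees (f ` V) (map_prod f f ` E) = ntrees V E"
proof -
  have "inj_on (map_prod f f) E"
    using map_prod_inj_on[OF assms(1,1)] assms(2) by (rule inj_on_subset)
  then show ?thesis unfolding ntrees_def
    using assms by (intro card_subsets_image stree_map_prod_iff) auto
qed

lemma nforests_map_prod:
  assumes "inj_on f V" "E \<subseteq> V \<times> V" "u \<in> V" "v \<in> V"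
  shows "nforests (f ` V) (map_prod f f ` E) (f u) (f v) = nforests V E u v"
proof -
  have inj: "inj_on (map_prod f f) (V \<times> V)"
    using map_prod_inj_on[OF assms(1,1)] .
  have "sforest (f ` V) (map_prod f f ` A) (f u) (f v) \<longleftrightarrow> sforest V A u v" if "A \<subseteq> E" for A
  proof -
    have A: "A \<subseteq> V \<times> V" using that assms by auto
    have 1: "(f x, f y) \<in> map_prod f f ` A \<longleftrightarrow> (x, y) \<in> A" if "x \<in> V" "y \<in> V" for x y
      using inj_on_image_mem_iff[OF inj, of "(x, y)" A] that A by auto
    have "sym (map_prod f f ` A) \<longleftrightarrow> sym A"
    proof
      assume *: "sym (map_prod f f ` A)"
      show "sym A"
      proof (rule symI)
        fix x y assume "(x, y) \<in> A"
        moreover from this have "x \<in> V" "y \<in> V" using A by auto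
        ultimately show "(y, x) \<in> A" using * 1 by (meson symD)
      qed
    qed (auto simp: sym_def)
    moreover have "map_prod f f ` A \<union> link (f u) (f v) = map_prod f f ` (A \<union> link u v)" by auto
    moreover have "stree (f ` V) (map_prod f f ` (A \<union> link u v)) \<longleftrightarrow> stree V (A \<union> link u v)"
      using A assms by (intro stree_map_prod_iff) auto
    ultimately show ?thesis unfolding sforest_def using 1 assms by simp
  qed
  then show ?thesis unfolding nforests_def
    using assms inj by (intro card_subsets_image) (auto intro: inj_on_subset)
qed

subsection \<open>Two-terminal gadgets\<close>

text \<open>
  Inner vertices \<open>W\<close> have degree \<open>k\<close> and the terminals \<open>u\<close>, \<open>v\<close> have degrees \<open>d1\<close>, \<open>d2\<close>; the flag \<open>a\<close>
  records whether the terminals are adjacent.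
\<close>

definition two_terminal ::
  "nat \<Rightarrow> bool \<Rightarrow> nat \<Rightarrow> nat \<Rightarrow> nat \<Rightarrow> nat \<Rightarrow> 'a set \<Rightarrow> 'a \<Rightarrow> 'a \<Rightarrow> ('a \<times> 'a) set \<Rightarrow> bool" where
  "two_terminal k a d1 d2 T F W u v E \<longleftrightarrow>
     E \<subseteq> insert u (insert v W) \<times> insert u (insert v W) \<and> sym E \<and> irrefl E \<and> ((u, v) \<in> E \<longleftrightarrow> a) \<and>
     (\<forall>x\<in>W. card (E `` {x}) = k) \<and> card (E `` {u}) = d1 \<and> card (E `` {v}) = d2 \<and>
     ntrees (insert u (insert v W)) E = T \<and> nforests (insert u (insert v W)) E u v = F"

text \<open>
  Quantifying over all placements of the vertices makes gluing possible without any renaming.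
\<close>

definition gadget :: "nat \<Rightarrow> bool \<Rightarrow> nat \<Rightarrow> nat \<Rightarrow> nat \<Rightarrow> nat \<Rightarrow> nat \<Rightarrow> bool" where
  "gadget k a d1 d2 s T F \<longleftrightarrow>
     (\<forall>(W::nat set) u v. finite W \<and> card W = s \<and> u \<notin> W \<and> v \<notin> W \<and> u \<noteq> v \<longrightarrow>
        (\<exists>E. two_terminal k a d1 d2 T F W u v E))"

lemma card_Image_Un_disjoint:
  assumes "finite E1" "finite E2" "E1 \<inter> E2 = {}"
  shows "card ((E1 \<union> E2) `` {x}) = card (E1 `` {x}) + card (E2 `` {x})"
  using assms by (subst Un_Image, intro card_Un_disjoint finite_Image) auto

lemma Image_outside: "E \<subseteq> V \<times> V \<Longrightarrow> x \<notin> V \<Longrightarrow> E `` {x} = {}"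
  by auto

lemma gadget_parallel:
  assumes "gadget k False d1 d2 s T F" "gadget k False d1' d2' s' T' F'"
  shows "gadget k False (d1 + d1') (d2 + d2') (s + s') (T * F' + F * T') (F * F')"
  unfolding gadget_def
proof (intro allI impI)
  fix W :: "nat set" and u v
  assume "finite W \<and> card W = s + s' \<and> u \<notin> W \<and> v \<notin> W \<and> u \<noteq> v"
  then have W: "finite W" "card W = s + s'" "u \<notin> W" "v \<notin> W" "u \<noteq> v" by auto
  obtain W1 where W1: "W1 \<subseteq> W" "card W1 = s"
    using obtain_subset_with_card_n[of s W] W(2) by auto
  define W2 where "W2 = W - W1"
  have fin: "finite W1" "finite W2" using W1 W(1) by (auto simp: W2_def intro: finite_subset)
  have W2: "card W2 = s'" using W W1 fin by (simp add: W2_def card_Diff_subset)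
  have WW: "W = W1 \<union> W2" "W1 \<inter> W2 = {}" using W1 by (auto simp: W2_def)
  obtain E1 where E1: "two_terminal k False d1 d2 T F W1 u v E1"
    using assms(1) fin W W1 unfolding gadget_def by (metis subsetD)
  obtain E2 where E2: "two_terminal k False d1' d2' T' F' W2 u v E2"
    using assms(2) fin W W2 unfolding gadget_def W2_def by (metis DiffD1)
  note E1 = E1[unfolded two_terminal_def] and E2 = E2[unfolded two_terminal_def]
  let ?V1 = "insert u (insert v W1)" and ?V2 = "insert u (insert v W2)"
  have V: "?V1 \<inter> ?V2 = {u, v}" "?V1 \<union> ?V2 = insert u (insert v W)" using WW W by auto
  have s1: "E1 \<subseteq> ?V1 \<times> ?V1" "sym E1" "finite E1"
    using E1 fin by (auto intro: finite_subset[of E1 "?V1 \<times> ?V1"])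
  have s2: "E2 \<subseteq> ?V2 \<times> ?V2" "sym E2" "finite E2"
    using E2 fin by (auto intro: finite_subset[of E2 "?V2 \<times> ?V2"])
  have nadj: "(u, v) \<notin> E1" "(u, v) \<notin> E2" "(v, u) \<notin> E1" "(u, u) \<notin> E1" "(v, v) \<notin> E1"
    using E1 E2 by (auto simp: sym_def irrefl_def)
  \<comment> \<open>The sides share only the terminals, so a common arc would be a loop or join the
    terminals.\<close>
  have disj: "E1 \<inter> E2 = {}"
  proof -
    have "E1 \<inter> E2 \<subseteq> (?V1 \<inter> ?V2) \<times> (?V1 \<inter> ?V2)" using s1(1) s2(1) by blast
    then show ?thesis unfolding V using nadj by auto
  qed
  note par = s1 s2 disj V(1) W(5)
  have "\<forall>x\<in>W. card ((E1 \<union> E2) `` {x}) = k"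
  proof
    fix x assume "x \<in> W"
    then consider "x \<in> W1" "x \<notin> ?V2" | "x \<in> W2" "x \<notin> ?V1" using WW W by blast
    then show "card ((E1 \<union> E2) `` {x}) = k"
      unfolding card_Image_Un_disjoint[OF s1(3) s2(3) disj]
      by cases (use E1 E2 Image_outside[OF s1(1)] Image_outside[OF s2(1)] in auto)
  qed
  moreover have "ntrees (insert u (insert v W)) (E1 \<union> E2) = T * F' + F * T'"
    "nforests (insert u (insert v W)) (E1 \<union> E2) u v = F * F'"
    using ntrees_parallel[OF par] nforests_parallel[OF par nadj(1,2)] E1 E2 unfolding V(2) by simp_all
  moreover have "E1 \<union> E2 \<subseteq> insert u (insert v W) \<times> insert u (insert v W)"
    unfolding V(2)[symmetric] using s1(1) s2(1) by blast
  moreover have "sym (E1 \<union> E2)" using s1(2) s2(2) by (rule sym_Un)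
  moreover have "irrefl (E1 \<union> E2)" using E1 E2 by (simp add: irrefl_def)
  moreover have "card ((E1 \<union> E2) `` {u}) = d1 + d1'" "card ((E1 \<union> E2) `` {v}) = d2 + d2'"
    unfolding card_Image_Un_disjoint[OF s1(3) s2(3) disj] using E1 E2 by simp_all
  ultimately have "two_terminal k False (d1 + d1') (d2 + d2') (T * F' + F * T') (F * F') W u v (E1 \<union> E2)"
    unfolding two_terminal_def using nadj by blast
  then show "\<exists>E. two_terminal k False (d1 + d1') (d2 + d2') (T * F' + F * T') (F * F') W u v E" ..
qed

text \<open>The shared terminal becomes an inner vertex, whence the \<open>Suc\<close> and the
  condition \<open>d + d' = k\<close>. The outer terminals lie on different sides and are
  nonadjacent whatever \<open>a\<close> and \<open>b\<close> are.\<close>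

lemma gadget_series:
  assumes "gadget k a d1 d s T F" "gadget k b d' d2 s' T' F'" and k: "d + d' = k"
  shows "gadget k False d1 d2 (Suc (s + s')) (T * T') (T * F' + F * T')"
  unfolding gadget_def
proof (intro allI impI)
  fix W :: "nat set" and u v
  assume "finite W \<and> card W = Suc (s + s') \<and> u \<notin> W \<and> v \<notin> W \<and> u \<noteq> v"
  then have W: "finite W" "card W = Suc (s + s')" "u \<notin> W" "v \<notin> W" "u \<noteq> v" by auto
  obtain W1 where W1: "W1 \<subseteq> W" "card W1 = s"
    using obtain_subset_with_card_n[of s W] W(2) by auto
  have "finite W1" using W1 W(1) finite_subset by blast
  then have "card (W - W1) = Suc s'" using W W1 by (simp add: card_Diff_subset)
  then obtain m W2 where mW2: "W - W1 = insert m W2" "m \<notin> W2" "card W2 = s'"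
    by (metis card_Suc_eq)
  have fin: "finite W1" "finite W2"
    using \<open>finite W1\<close> finite_subset[of W2 W] W(1) mW2(1) by auto
  have WW: "W = insert m (W1 \<union> W2)" "W1 \<inter> W2 = {}" "m \<notin> W1" "m \<notin> W2" using W1 mW2 by auto
  have m: "m \<noteq> u" "m \<noteq> v" using WW W by auto
  obtain E1 where E1: "two_terminal k a d1 d T F W1 u m E1"
    using assms(1) fin W WW W1 m unfolding gadget_def by (metis subsetD)
  obtain E2 where E2: "two_terminal k b d' d2 T' F' W2 m v E2"
    using assms(2) fin W WW mW2(3) m unfolding gadget_def by (metis UnCI insertCI)
  note E1 = E1[unfolded two_terminal_def] and E2 = E2[unfolded two_terminal_def]
  let ?V1 = "insert u (insert m W1)" and ?V2 = "insert m (insert v W2)"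
  have V: "?V1 \<inter> ?V2 = {m}" "?V1 \<union> ?V2 = insert u (insert v W)" using WW W m by auto
  have s1: "E1 \<subseteq> ?V1 \<times> ?V1" "sym E1" "finite E1"
    using E1 fin by (auto intro: finite_subset[of E1 "?V1 \<times> ?V1"])
  have s2: "E2 \<subseteq> ?V2 \<times> ?V2" "sym E2" "finite E2"
    using E2 fin by (auto intro: finite_subset[of E2 "?V2 \<times> ?V2"])
  have disj: "E1 \<inter> E2 = {}"
  proof -
    have "E1 \<inter> E2 \<subseteq> (?V1 \<inter> ?V2) \<times> (?V1 \<inter> ?V2)" using s1(1) s2(1) by blast
    then show ?thesis unfolding V using E1 by (auto simp: irrefl_def)
  qed
  have out: "u \<notin> ?V2" "v \<notin> ?V1" using W WW m by auto
  have nadj: "(u, v) \<notin> E1" "(u, v) \<notin> E2" using out s1(1) s2(1) by blast+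
  note ser = s1 s2 disj V(1)
  note deg = card_Image_Un_disjoint[OF s1(3) s2(3) disj]
  have "\<forall>x\<in>W. card ((E1 \<union> E2) `` {x}) = k"
  proof
    fix x assume "x \<in> W"
    then consider "x \<in> W1" "x \<notin> ?V2" | "x \<in> W2" "x \<notin> ?V1" | "x = m" using WW W by blast
    then show "card ((E1 \<union> E2) `` {x}) = k"
      unfolding deg
      by cases (use E1 E2 k Image_outside[OF s1(1)] Image_outside[OF s2(1)] in auto)
  qed
  moreover have "nforests (?V1 \<union> ?V2) (E1 \<union> E2) u v =
      ntrees ?V1 E1 * nforests ?V2 E2 m v + nforests ?V1 E1 u m * ntrees ?V2 E2"
    using m by (intro nforests_series[OF ser]) auto
  then have "nforests (insert u (insert v W)) (E1 \<union> E2) u v = T * F' + F * T'"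
    using E1 E2 unfolding V(2) by simp
  moreover have "ntrees (insert u (insert v W)) (E1 \<union> E2) = T * T'"
    using ntrees_series[OF ser] E1 E2 unfolding V(2) by simp
  moreover have "E1 \<union> E2 \<subseteq> insert u (insert v W) \<times> insert u (insert v W)"
    unfolding V(2)[symmetric] using s1(1) s2(1) by blast
  moreover have "sym (E1 \<union> E2)" using s1(2) s2(2) by (rule sym_Un)
  moreover have "irrefl (E1 \<union> E2)" using E1 E2 by (simp add: irrefl_def)
  moreover have "card ((E1 \<union> E2) `` {u}) = d1" "card ((E1 \<union> E2) `` {v}) = d2"
    unfolding deg Image_outside[OF s1(1) out(2)] Image_outside[OF s2(1) out(1)] using E1 E2 by simp_all
  ultimately have "two_terminal k False d1 d2 (T * T') (T * F' + F * T') W u v (E1 \<union> E2)"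
    unfolding two_terminal_def using nadj by blast
  then show "\<exists>E. two_terminal k False d1 d2 (T * T') (T * F' + F * T') W u v E" ..
qed

text \<open>Of the symmetric subsets of a link, only the link itself is a tree and only the empty
  set is a separating forest.\<close>

lemma gadget_edge: "gadget k True 1 1 0 1 1"
  unfolding gadget_def
proof (intro allI impI)
  fix W :: "nat set" and u v
  assume "finite W \<and> card W = 0 \<and> u \<notin> W \<and> v \<notin> W \<and> u \<noteq> v"
  then have W: "W = {}" "u \<noteq> v" by auto
  have sub: "A = {} \<or> A = link u v" if "A \<subseteq> link u v" "sym A" for A
    using that by (auto simp: sym_def)
  have "A \<subseteq> link u v \<and> stree {u, v} A \<longleftrightarrow> A = link u v" for A
  proof
    assume A: "A \<subseteq> link u v \<and> stree {u, v} A"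
    then have "(u, v) \<in> A\<^sup>*" by (simp add: stree_def)
    then have "A \<noteq> {}" using W by auto
    then show "A = link u v" using sub A stree_imp_sym by blast
  qed (simp add: stree_link W)
  then have "ntrees {u, v} (link u v) = 1" unfolding ntrees_def by simp
  moreover have "A \<subseteq> link u v \<and> sforest {u, v} A u v \<longleftrightarrow> A = {}" for A
  proof
    assume A: "A \<subseteq> link u v \<and> sforest {u, v} A u v"
    then show "A = {}" using sub[of A] by (auto simp: sforest_def)
  next
    assume "A = {}"
    then show "A \<subseteq> link u v \<and> sforest {u, v} A u v"
      using stree_link[OF W(2)] by (simp add: sforest_def sym_def)
  qed
  then have "nforests {u, v} (link u v) u v = 1" unfolding nforests_def by simp
  moreover have "link u v `` {u} = {v}" "link u v `` {v} = {u}" using W by auto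
  ultimately have "two_terminal k True 1 1 1 1 W u v (link u v)"
    unfolding two_terminal_def using W by (auto simp: sym_def irrefl_def)
  then show "\<exists>E. two_terminal k True 1 1 1 1 W u v E" ..
qed

section \<open>Existence of spanning trees\<close>

lemma spanning_stree_exists:
  assumes "finite E" "sym E" "E \<subseteq> V \<times> V" "\<forall>x\<in>V. \<forall>y\<in>V. (x, y) \<in> E\<^sup>*"
  shows "\<exists>A\<subseteq>E. stree V A"
  using assms
proof (induction E rule: finite_psubset_induct)
  case (psubset E)
  show ?case
  proof (cases "\<forall>x y. (x, y) \<in> E \<longrightarrow> (x, y) \<notin> (E - link x y)\<^sup>*")
    case True
    then have "stree V E" using psubset.prems by (simp add: stree_def)
    then show ?thesis by blast
  next
    case False
    then obtain x y where xy: "(x, y) \<in> E" "(x, y) \<in> (E - link x y)\<^sup>*" by blast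
    \<comment> \<open>Deleting an edge that is no bridge preserves reachability, so the induction
      ends in a tree.\<close>
    let ?E = "E - link x y"
    have sym: "sym ?E" using psubset.prems by (auto simp: sym_def)
    have "E \<subseteq> ?E\<^sup>*" using xy(2) sym_rtranclD[OF sym xy(2)] by auto
    then have "E\<^sup>* \<subseteq> ?E\<^sup>*" by (rule rtrancl_subset_rtrancl)
    then have "\<exists>A\<subseteq>?E. stree V A"
      using psubset.prems xy(1) sym by (intro psubset.IH) auto
    then show ?thesis by blast
  qed
qed

lemma ntrees_pos:
  assumes "finite E" "sym E" "E \<subseteq> V \<times> V" "\<forall>x\<in>V. \<forall>y\<in>V. (x, y) \<in> E\<^sup>*"
  shows "ntrees V E > 0"
proof -
  have "finite {A. A \<subseteq> E \<and> stree V A}" using assms(1) by simp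
  then show ?thesis unfolding ntrees_def using spanning_stree_exists[OF assms] by (auto simp: card_gt_0_iff)
qed

subsection \<open>Circulant graphs\<close>

text \<open>The Cayley graph of the integers modulo \<open>s\<close> with connection set
  \<open>D\<close>, on the representatives below \<open>s\<close>.\<close>

definition circulant :: "nat \<Rightarrow> nat set \<Rightarrow> (nat \<times> nat) set" where
  "circulant s D = {(x, y). x < s \<and> (\<exists>d\<in>D. y = (x + d) mod s)}"

text \<open>Take the offsets from 1 to \<open>h\<close> and their negatives. For odd
  \<open>k\<close> the order \<open>s\<close> is even, and the self-inverse offset
  \<open>s / 2\<close> supplies the missing one. Offset 1 later provides a Hamiltonian
  cycle.\<close>

lemma circulant_offsets_exist:
  assumes "k \<ge> 3" "s > k" "even (k * s)"
  obtains D where "D \<subseteq> {1..<s}" "card D = k" "1 \<in> D" "\<And>d. d \<in> D \<Longrightarrow> s - d \<in> D"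
proof (cases "even k")
  case True
  then obtain h where h: "k = 2 * h" by blast
  let ?D = "{1..h} \<union> {s - h..<s}"
  have "card ?D = k" using assms h by (subst card_Un_disjoint) auto
  moreover have "?D \<subseteq> {1..<s}" "1 \<in> ?D" using assms h by auto
  moreover have "s - d \<in> ?D" if "d \<in> ?D" for d using that assms h by auto
  ultimately show ?thesis using that by blast
next
  case False
  then obtain h where h: "k = 2 * h + 1" using oddE by blast
  from assms False obtain r where r: "s = 2 * r" by auto
  have rh: "h < r" using assms h r by auto
  let ?D = "{1..h} \<union> {s - h..<s}"
  have "card ?D = 2 * h" using rh r by (subst card_Un_disjoint) auto
  moreover have "r \<notin> ?D" using rh r by auto
  ultimately have "card (insert r ?D) = k" using h by simp
  moreover have "insert r ?D \<subseteq> {1..<s}" "1 \<in> insert r ?D" using assms h rh r by auto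
  moreover have "s - d \<in> insert r ?D" if "d \<in> insert r ?D" for d using that rh r by auto
  ultimately show ?thesis using that by blast
qed

context
  fixes s k :: nat and D :: "nat set"
  assumes D: "D \<subseteq> {1..<s}" "card D = k" "1 \<in> D" "\<And>d. d \<in> D \<Longrightarrow> s - d \<in> D"
    and s: "s > 3"
begin

lemma circulant_subset: "circulant s D \<subseteq> {..<s} \<times> {..<s}"
  using s by (auto simp: circulant_def)

lemma finite_circulant: "finite (circulant s D)"
  using circulant_subset by (rule finite_subset) simp

lemma sym_circulant: "sym (circulant s D)"
proof (rule symI)
  fix x y assume "(x, y) \<in> circulant s D"
  then obtain d where d: "x < s" "d \<in> D" "y = (x + d) mod s" by (auto simp: circulant_def)
  have "d < s" using d D by auto
  have "(y + (s - d)) mod s = (x + d + (s - d)) mod s" unfolding d by (simp add: mod_add_left_eq)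
  also have "\<dots> = x" using d \<open>d < s\<close> by simp
  finally show "(y, x) \<in> circulant s D" using d D(4) s by (auto simp: circulant_def intro!: bexI[of _ "s - d"])
qed

lemma circulant_Image: "x < s \<Longrightarrow> circulant s D `` {x} = (\<lambda>d. (x + d) mod s) ` D"
  by (auto simp: circulant_def)

lemma inj_on_shift_mod: "x < s \<Longrightarrow> inj_on (\<lambda>d. (x + d) mod s) D"
proof (rule inj_onI)
  fix d e assume "x < s" "d \<in> D" "e \<in> D" "(x + d) mod s = (x + e) mod s"
  moreover have "d < s" "e < s" using calculation D(1) by auto
  ultimately show "d = e"
    by (cases "x + d < s"; cases "x + e < s") (auto simp: mod_if split: if_splits)
qed

lemma card_circulant_Image: "x < s \<Longrightarrow> card (circulant s D `` {x}) = k"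
  using D(2) by (simp add: circulant_Image card_image inj_on_shift_mod)

lemma irrefl_circulant: "irrefl (circulant s D)"
proof (rule irreflI)
  fix x
  show "(x, x) \<notin> circulant s D"
  proof
    assume "(x, x) \<in> circulant s D"
    then obtain d where d: "x < s" "d \<in> D" "x = (x + d) mod s" by (auto simp: circulant_def)
    then have "d < s" "d > 0" using D(1) by auto
    then show False using d by (auto simp: mod_if split: if_splits)
  qed
qed

lemma circulant_step: "x < s \<Longrightarrow> (x, (x + 1) mod s) \<in> circulant s D"
  using D(3) unfolding circulant_def by blast

text \<open>Offset 1 gives a Hamiltonian cycle; deleting the edge between 0 and 1 leaves the path
  \<open>1, 2, ..., s - 1, 0\<close>.\<close>

lemma circulant_minus_link_connected:
  "\<forall>x\<in>{..<s}. \<forall>y\<in>{..<s}. (x, y) \<in> (circulant s D - link 0 1)\<^sup>*"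
proof -
  let ?E = "circulant s D - link 0 1"
  have sym: "sym ?E" using sym_circulant by (auto simp: sym_def)
  have reach: "Suc i < s \<Longrightarrow> (1, Suc i) \<in> ?E\<^sup>*" for i
  proof (induction i)
    case (Suc i)
    have "(Suc i, Suc (Suc i)) \<in> ?E"
      using circulant_step[of "Suc i"] Suc.prems by auto
    then show ?case using Suc by (auto intro: rtrancl_into_rtrancl)
  qed simp
  have "(s - 1, 0) \<in> ?E" using circulant_step[of "s - 1"] s by auto
  moreover have "(1, s - 1) \<in> ?E\<^sup>*" using reach[of "s - 2"] s
    by (simp add: Suc_diff_Suc numeral_2_eq_2)
  ultimately have "(1, 0) \<in> ?E\<^sup>*" by (rule rtrancl_into_rtrancl[rotated])
  then have all: "(1, x) \<in> ?E\<^sup>*" if "x < s" for x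
    using reach[of "x - 1"] that by (cases x) auto
  then show ?thesis using sym_rtranclD[OF sym] by (blast intro: rtrancl_trans)
qed

text \<open>The deleted edge lowers the degrees of 0 and 1, the future terminals, to
  \<open>k - 1\<close>. The counts stay symbolic; what is used of them later is that the number of
  trees is positive.\<close>

lemma gadget_circulant_minus_link:
  "gadget k False (k - 1) (k - 1) (s - 2) (ntrees {..<s} (circulant s D - link 0 1))
     (nforests {..<s} (circulant s D - link 0 1) 0 1)"
  unfolding gadget_def
proof (intro allI impI)
  let ?E = "circulant s D - link 0 1"
  fix W :: "nat set" and u v
  assume "finite W \<and> card W = s - 2 \<and> u \<notin> W \<and> v \<notin> W \<and> u \<noteq> v"
  then have W: "finite W" "card W = s - 2" "u \<notin> W" "v \<notin> W" "u \<noteq> v" by auto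
  obtain g where g: "bij_betw g {2..<s} W"
    using finite_same_card_bij[of "{2..<s}" W] W by auto
  define f where "f i = (if i = 0 then u else if i = 1 then v else g i)" for i :: nat
  have ins: "{..<s} = insert 0 (insert 1 {2..<s})" using s by auto
  have fg: "f ` {2..<s} = W"
  proof -
    have "f ` {2..<s} = g ` {2..<s}" by (rule image_cong) (auto simp: f_def)
    then show ?thesis using g by (simp add: bij_betw_def)
  qed
  have f01: "f 0 = u" "f 1 = v" by (auto simp: f_def)
  have fV: "f ` {..<s} = insert u (insert v W)" unfolding ins using fg f01 by simp
  \<comment> \<open>Injectivity by counting: the image also has \<open>s\<close> elements.\<close>
  have inj: "inj_on f {..<s}"
    using s W by (intro eq_card_imp_inj_on) (auto simp: fV)
  have sub: "?E \<subseteq> {..<s} \<times> {..<s}" using circulant_subset by auto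
  let ?F = "map_prod f f ` ?E"
  have mem: "(f x, f y) \<in> ?F \<longleftrightarrow> (x, y) \<in> ?E" if "x < s" "y < s" for x y
    using inj_on_image_mem_iff[OF map_prod_inj_on[OF inj inj], of "(x, y)" ?E] that sub by auto
  have img: "?F `` {f x} = f ` (?E `` {x})" if "x < s" for x
  proof -
    have "f x = f x' \<Longrightarrow> (x', y) \<in> ?E \<Longrightarrow> x = x'" for x' y
      using inj sub that by (auto dest: inj_onD)
    then show ?thesis by force
  qed
  have deg: "card (?F `` {f x}) = card (?E `` {x})" if "x < s" for x
    unfolding img[OF that] using sub by (intro card_image inj_on_subset[OF inj]) auto
  have E01: "(0, 1) \<in> circulant s D" "(1, 0) \<in> circulant s D"
    using circulant_step[of 0] s sym_circulant by (auto simp: sym_def)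
  have deg0: "card (?E `` {0}) = k - 1"
  proof -
    have "?E `` {0} = circulant s D `` {0} - {1}" by auto
    moreover have "1 \<in> circulant s D `` {0}" using E01 by auto
    ultimately show ?thesis using card_circulant_Image[of 0] s by (simp add: card_Diff_singleton)
  qed
  have deg1: "card (?E `` {1}) = k - 1"
  proof -
    have "?E `` {1} = circulant s D `` {1} - {0}" by auto
    moreover have "0 \<in> circulant s D `` {1}" using E01 by auto
    ultimately show ?thesis using card_circulant_Image[of 1] s by (simp add: card_Diff_singleton)
  qed
  have degk: "card (?F `` {y}) = k" if "y \<in> W" for y
  proof -
    from that fg obtain x where x: "x \<in> {2..<s}" "y = f x" by blast
    have "?E `` {x} = circulant s D `` {x}" using x by auto
    then show ?thesis using deg[of x] card_circulant_Image[of x] x by simp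
  qed
  have "sym ?F" using sym_circulant by (auto simp: sym_def)
  moreover have "irrefl ?F"
  proof (rule irreflI, rule notI)
    fix y assume "(y, y) \<in> ?F"
    then obtain p where p: "p \<in> ?E" "(y, y) = map_prod f f p" by (rule imageE)
    obtain x x' where xx': "p = (x, x')" by (rule prod.exhaust)
    have x: "(x, x') \<in> ?E" "f x = f x'" using p unfolding xx' by simp_all
    then have "x = x'" using inj sub by (auto dest: inj_onD)
    then show False using x irrefl_circulant by (auto simp: irrefl_def)
  qed
  moreover have "(u, v) \<notin> ?F" using mem[of 0 1] s f01 by simp
  moreover have "?F \<subseteq> f ` {..<s} \<times> f ` {..<s}" using sub by auto
  moreover have "card (?F `` {u}) = k - 1" "card (?F `` {v}) = k - 1"
    using deg[of 0] deg[of 1] deg0 deg1 s f01 by auto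
  moreover have "ntrees (f ` {..<s}) ?F = ntrees {..<s} ?E"
    by (rule ntrees_map_prod[OF inj sub])
  moreover have "nforests (f ` {..<s}) ?F u v = nforests {..<s} ?E 0 1"
    using nforests_map_prod[OF inj sub, of 0 1] s f01 by simp
  ultimately have "two_terminal k False (k - 1) (k - 1) (ntrees {..<s} ?E) (nforests {..<s} ?E 0 1) W u v ?F"
    unfolding two_terminal_def using degk fV by simp
  then show "\<exists>F. two_terminal k False (k - 1) (k - 1) (ntrees {..<s} ?E) (nforests {..<s} ?E 0 1) W u v F" ..
qed

end

lemma base_gadget_exists:
  assumes "k \<ge> 3" "s > k" "even (k * s)"
  shows "\<exists>t f. t > 0 \<and> gadget k False (k - 1) (k - 1) (s - 2) t f"
proof -
  obtain D where D: "D \<subseteq> {1..<s}" "card D = k" "1 \<in> D" "\<And>d. d \<in> D \<Longrightarrow> s - d \<in> D"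
    using circulant_offsets_exist[OF assms] by metis
  have s: "s > 3" using assms by simp
  let ?E = "circulant s D - link 0 1"
  have "sym ?E" using sym_circulant[OF D s] by (auto simp: sym_def)
  moreover have "finite ?E" using finite_circulant[OF D s] by simp
  moreover have "?E \<subseteq> {..<s} \<times> {..<s}" using circulant_subset[OF D s] by auto
  ultimately have "ntrees {..<s} ?E > 0"
    using circulant_minus_link_connected[OF D s] by (intro ntrees_pos)
  then show ?thesis using gadget_circulant_minus_link[OF D s] by blast
qed

subsection \<open>Pair graphs\<close>

lemma pair_graph_iff:
  "pair_graph G \<longleftrightarrow> parcs G \<subseteq> pverts G \<times> pverts G \<and> finite (pverts G) \<and> sym (parcs G) \<and> irrefl (parcs G)"
proof
  assume "pair_graph G"
  then interpret pair_graph G .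
  have "parcs G \<subseteq> pverts G \<times> pverts G" using wellformed' by auto
  moreover have "sym (parcs G)" using pair_sym_arcs by (auto simp: symmetric_def)
  moreover have "irrefl (parcs G)" using pair_no_loops by (fastforce simp: irrefl_def)
  ultimately show "parcs G \<subseteq> pverts G \<times> pverts G \<and> finite (pverts G) \<and> sym (parcs G) \<and> irrefl (parcs G)"
    using pair_finite_verts by blast
next
  assume *: "parcs G \<subseteq> pverts G \<times> pverts G \<and> finite (pverts G) \<and> sym (parcs G) \<and> irrefl (parcs G)"
  then have "finite (parcs G)" by (meson finite_SigmaI finite_subset)
  with * show "pair_graph G"
    by unfold_locales (auto simp: symmetric_def irrefl_def)
qed

lemma connected_pair_graph_iff:
  assumes "pair_graph G"
  shows "Digraph_Component.connected (with_proj G) \<longleftrightarrow>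
    pverts G \<noteq> {} \<and> (\<forall>x\<in>pverts G. \<forall>y\<in>pverts G. (x, y) \<in> (parcs G)\<^sup>*)"
proof -
  interpret pair_graph G by fact
  show ?thesis
    by (auto simp: Digraph_Component.connected_def strongly_connected_def
        reachable_mk_symmetric_eq[OF sym_arcs] reachable_conv)
qed

lemma pcas_imp_rtrancl: "pcas u p v \<Longrightarrow> set p \<subseteq> A \<Longrightarrow> (u, v) \<in> A\<^sup>*"
proof (induction p arbitrary: u)
  case (Cons e p)
  then have "(u, snd e) \<in> A" "(snd e, v) \<in> A\<^sup>*" by (cases e; auto)+
  then show ?case by (rule converse_rtrancl_into_rtrancl)
qed simp

lemma pcas_pawalk_verts: "pcas u p v \<Longrightarrow> pawalk_verts u p = u # map snd p"
  by (induction p arbitrary: u) (auto simp: Nil_is_map_conv)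

lemma pcas_fst_in: "pcas u p v \<Longrightarrow> e \<in> set p \<Longrightarrow> fst e \<in> set (u # map snd p)"
  by (induction p arbitrary: u) auto

lemma pcas_end: "pcas u p v \<Longrightarrow> v = last (u # map snd p)"
  by (induction p arbitrary: u) auto

lemma pcas_snoc: "pcas u p v \<Longrightarrow> pcas u (p @ [(v, w)]) w"
  by (induction p arbitrary: u) auto

text \<open>The first arc of a long cycle is bypassed by the rest, which uses neither orientation of
  it. Conversely, a simple path around an edge has length at least 2, and the reversed arc closes it
  to a long cycle.\<close>

lemma long_cycle_iff:
  assumes G: "pair_graph G"
  shows "(\<exists>p. pre_digraph.cycle (with_proj G) p \<and> 3 \<le> length p) \<longleftrightarrow>
    (\<exists>x y. (x, y) \<in> parcs G \<and> (x, y) \<in> (parcs G - link x y)\<^sup>*)"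
proof -
  interpret G: pair_graph G by fact
  note G' = G[unfolded pair_graph_iff]
  show ?thesis
  proof
    assume "\<exists>p. G.cycle p \<and> 3 \<le> length p"
    then obtain p u where p: "G.awalk u p u" "distinct (tl (G.awalk_verts u p))" "3 \<le> length p"
      unfolding G.cycle_def by blast
    then have cas: "pcas u p u" and arcs: "set p \<subseteq> parcs G" by (auto simp: G.awalk_def)
    have dist: "distinct (map snd p)" using p(2) pcas_pawalk_verts[OF cas] by simp
    obtain y q where q: "p = (u, y) # q" using cas p(3) by (cases p) auto
    have casq: "pcas y q u" using cas q by simp
    have y: "y \<notin> set (map snd q)" using dist q by simp
    obtain z r where r: "q = (y, z) # r" using casq q p(3) by (cases q) auto
    have rne: "r \<noteq> []" using q r p(3) by auto
    have casr: "pcas z r u" using casq r by simp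
    have "(u, y) \<notin> set q" using y by force
    \<comment> \<open>Since \<open>y\<close> is not a head in \<open>q\<close>, the arc
      \<open>(y, u)\<close> could only be the first arc of \<open>q\<close>, so
      \<open>z = u\<close>. But \<open>r\<close> is nonempty and ends in \<open>u\<close>, which
      would repeat a vertex.\<close>
    moreover have "(y, u) \<notin> set q"
    proof
      assume "(y, u) \<in> set q"
      moreover have "(y, u) \<notin> set r"
      proof
        assume "(y, u) \<in> set r"
        then have "y \<in> set (z # map snd r)" using pcas_fst_in[OF casr] by force
        then show False using y r by auto
      qed
      ultimately have "z = u" using r by auto
      moreover have "u \<in> set (map snd r)" using pcas_end[OF casr] rne last_in_set[of "map snd r"] by simp
      ultimately show False using dist q r by auto
    qed
    ultimately have "set q \<subseteq> parcs G - link u y" using arcs q by auto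
    then have "(y, u) \<in> (parcs G - link u y)\<^sup>*" by (rule pcas_imp_rtrancl[OF casq])
    moreover have "sym (parcs G - link u y)" using G' by (auto simp: sym_def)
    ultimately have "(u, y) \<in> (parcs G - link u y)\<^sup>*" by (metis sym_rtranclD)
    then show "\<exists>x y. (x, y) \<in> parcs G \<and> (x, y) \<in> (parcs G - link x y)\<^sup>*"
      using arcs q by auto
  next
    assume "\<exists>x y. (x, y) \<in> parcs G \<and> (x, y) \<in> (parcs G - link x y)\<^sup>*"
    then obtain x y where xy: "(x, y) \<in> parcs G" "(x, y) \<in> (parcs G - link x y)\<^sup>*" by blast
    let ?H = "\<lparr>pverts = pverts G, parcs = parcs G - link x y\<rparr>"
    have V: "x \<in> pverts G" "y \<in> pverts G" "x \<noteq> y" "(y, x) \<in> parcs G"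
      using G' xy(1) by (auto simp: irrefl_def sym_def)
    have H: "pair_graph ?H" using G' unfolding pair_graph_iff by (auto simp: sym_def irrefl_def)
    then interpret H: pair_graph ?H .
    have "x \<rightarrow>\<^sup>*\<^bsub>with_proj ?H\<^esub> y" using xy(2) V by (simp add: H.reachable_conv)
    then obtain p where p: "H.apath x p y" using H.reachable_apath by blast
    then have cas: "pcas x p y" and arcs: "set p \<subseteq> parcs G - link x y"
      by (auto simp: H.apath_def H.awalk_def)
    have dist: "distinct (x # map snd p)"
      using p pcas_pawalk_verts[OF cas] by (simp add: H.apath_def)
    have len: "length p \<ge> 2"
    proof (rule ccontr)
      assume "\<not> length p \<ge> 2"
      then have "p = [] \<or> (\<exists>e. p = [e])" by (cases p; cases "tl p") auto
      then show False using cas arcs V by auto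
    qed
    let ?c = "p @ [(y, x)]"
    have cas': "pcas x ?c x" using cas by (rule pcas_snoc)
    moreover have "set ?c \<subseteq> parcs G" using arcs V(4) by auto
    ultimately have "G.awalk x ?c x"
      using V(1) unfolding G.awalk_def cas_with_proj_eq with_proj_simps by blast
    moreover have "distinct (tl (G.awalk_verts x ?c))"
      unfolding awalk_verts_with_proj_eq pcas_pawalk_verts[OF cas'] using dist by simp
    ultimately have "G.cycle ?c" unfolding G.cycle_def by blast
    then show "\<exists>p. G.cycle p \<and> 3 \<le> length p" using len by (intro exI[of _ ?c]) simp
  qed
qed

lemma undirected_tree_iff:
  assumes "finite V" "V \<noteq> {}"
  shows "undirected_tree \<lparr>pverts = V, parcs = A\<rparr> \<longleftrightarrow> stree V A"
proof
  assume T: "undirected_tree \<lparr>pverts = V, parcs = A\<rparr>"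
  then have G: "pair_graph \<lparr>pverts = V, parcs = A\<rparr>" by (simp add: undirected_tree_def)
  show "stree V A"
    using T G[unfolded pair_graph_iff] unfolding undirected_tree_def long_cycle_iff[OF G] connected_pair_graph_iff[OF G]
    by (simp add: stree_def)
next
  assume T: "stree V A"
  \<comment> \<open>A loop violates the bridge condition because reachability is reflexive.\<close>
  have "irrefl A" using T by (auto simp: stree_def irrefl_def)
  then have G: "pair_graph \<lparr>pverts = V, parcs = A\<rparr>"
    using T assms by (simp add: pair_graph_iff stree_def)
  then show "undirected_tree \<lparr>pverts = V, parcs = A\<rparr>"
    using T assms unfolding undirected_tree_def long_cycle_iff[OF G] connected_pair_graph_iff[OF G]
    by (simp add: stree_def)
qed

lemma num_spanning_trees_eq_ntrees:
  assumes G: "pair_graph \<lparr>pverts = V, parcs = E\<rparr>" and V: "V \<noteq> {}"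
  shows "num_spanning_trees \<lparr>pverts = V, parcs = E\<rparr> = ntrees V E"
proof -
  let ?G = "\<lparr>pverts = V, parcs = E\<rparr>" and ?f = "\<lambda>A. \<lparr>pverts = V, parcs = A\<rparr>"
  have fin: "finite V" and E: "E \<subseteq> V \<times> V" using G by (auto simp: pair_graph_iff)
  have wfG: "wf_digraph (with_proj ?G)"
    using E by unfold_locales auto
  have "{T. undirected_tree T \<and> spanning (with_proj T) (with_proj ?G)} = ?f ` {A. A \<subseteq> E \<and> stree V A}"
    (is "?L = ?R")
  proof (intro equalityI subsetI)
    fix T assume T: "T \<in> ?L"
    then have eq: "T = ?f (parcs T)" and sub: "parcs T \<subseteq> E"
      by (auto simp: spanning_def subgraph_def)
    have "stree V (parcs T)" using T undirected_tree_iff[OF fin V, of "parcs T"] eq by simp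
    then show "T \<in> ?R" using eq sub by blast
  next
    fix T assume "T \<in> ?R"
    then obtain A where A: "T = ?f A" "A \<subseteq> E" "stree V A" by blast
    have "wf_digraph (with_proj T)" using A E by unfold_locales auto
    then have "spanning (with_proj T) (with_proj ?G)"
      using A wfG by (simp add: spanning_def subgraph_def compatible_def)
    then show "T \<in> ?L" using A undirected_tree_iff[OF fin V] by simp
  qed
  moreover have "inj_on ?f {A. A \<subseteq> E \<and> stree V A}" by (rule inj_onI) simp
  ultimately show ?thesis unfolding num_spanning_trees_def ntrees_def by (simp add: card_image)
qed

lemma gadget_imp_regular_graph:
  assumes "gadget k False k k s T F" "T > 0"
  shows "\<exists>G :: nat pair_pre_digraph. regular_graph k G \<and> Digraph_Component.connected (with_proj G) \<and>
    card (pverts G) = s + 2 \<and> num_spanning_trees G = T"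
proof -
  let ?W = "{2..<s + 2}"
  have "\<exists>E. two_terminal k False k k T F ?W 0 1 E"
    using assms(1) unfolding gadget_def by (elim allE[of _ ?W] allE[of _ 0] allE[of _ 1] impE) auto
  then obtain E where E: "two_terminal k False k k T F ?W 0 1 E" by blast
  let ?V = "insert 0 (insert 1 ?W)"
  let ?G = "\<lparr>pverts = ?V, parcs = E\<rparr>"
  note E = E[unfolded two_terminal_def]
  have G: "pair_graph ?G" using E by (simp add: pair_graph_iff)
  have ntr: "num_spanning_trees ?G = T" using num_spanning_trees_eq_ntrees[OF G] E by simp
  \<comment> \<open>A positive tree count provides a spanning tree and hence connectivity.\<close>
  have "{A. A \<subseteq> E \<and> stree ?V A} \<noteq> {}"
  proof
    assume "{A. A \<subseteq> E \<and> stree ?V A} = {}"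
    then have "ntrees ?V E = 0" unfolding ntrees_def by (metis card.empty)
    then show False using E assms(2) by simp
  qed
  then obtain A where A: "A \<subseteq> E" "stree ?V A" by blast
  have "A\<^sup>* \<subseteq> E\<^sup>*" using A(1) by (rule rtrancl_mono)
  then have conn: "Digraph_Component.connected (with_proj ?G)"
    using A(2) unfolding connected_pair_graph_iff[OF G] stree_def by (simp add: subset_iff)
  have "out_degree (with_proj ?G) x = k" if "x \<in> ?V" for x
  proof -
    have "out_arcs (with_proj ?G) x = Pair x ` (E `` {x})" by (auto simp: out_arcs_def)
    then have "out_degree (with_proj ?G) x = card (E `` {x})"
      unfolding out_degree_def by (simp add: card_image inj_on_def)
    then show ?thesis using E that by auto
  qed
  then have "regular_graph k ?G" using G by (simp add: regular_graph_def)
  moreover have "card ?V = s + 2" by simp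
  ultimately show ?thesis using conn ntr by (intro exI[of _ ?G]) simp
qed

text \<open>Any \<open>n\<close> naturals may serve as vertices, so the graphs can be infinitely
  many, but each value is at most the number of arc sets. Finiteness matters because
  \<open>card\<close> of an infinite set is 0.\<close>

lemma finite_num_spanning_trees_values:
  "finite {num_spanning_trees G | G :: nat pair_pre_digraph.
     regular_graph k G \<and> Digraph_Component.connected (with_proj G) \<and> card (pverts G) = n}"
proof (rule finite_subset)
  show "{num_spanning_trees G | G :: nat pair_pre_digraph.
     regular_graph k G \<and> Digraph_Component.connected (with_proj G) \<and> card (pverts G) = n} \<subseteq> {..2 ^ (n * n)}"
  proof
    fix x
    assume "x \<in> {num_spanning_trees G | G :: nat pair_pre_digraph.
      regular_graph k G \<and> Digraph_Component.connected (with_proj G) \<and> card (pverts G) = n}"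
    then obtain G :: "nat pair_pre_digraph" where x: "x = num_spanning_trees G" "card (pverts G) = n"
      and G: "regular_graph k G" "Digraph_Component.connected (with_proj G)" by blast
    let ?V = "pverts G" and ?E = "parcs G"
    have eq: "G = \<lparr>pverts = ?V, parcs = ?E\<rparr>" by simp
    have pg: "pair_graph G" using G by (simp add: regular_graph_def)
    then have fin: "finite ?V" and E: "?E \<subseteq> ?V \<times> ?V" by (auto simp: pair_graph_iff)
    have ne: "?V \<noteq> {}" using G connected_pair_graph_iff[OF pg] by simp
    have "num_spanning_trees G = ntrees ?V ?E"
      using num_spanning_trees_eq_ntrees[of ?V ?E] pg ne eq by metis
    also have "\<dots> \<le> card (Pow (?V \<times> ?V))"
      unfolding ntrees_def using fin E by (intro card_mono) auto
    also have "\<dots> = 2 ^ (card ?V * card ?V)" using fin by (simp add: card_Pow card_cartesian_product)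
    finally show "x \<in> {..2 ^ (n * n)}" using x by simp
  qed
qed simp

subsection \<open>Words of gadgets\<close>

text \<open>
  A pair \<open>(T, F)\<close> holds the number of spanning trees and of separating two-component forests of a
  two-terminal graph.
\<close>

definition par :: "nat \<times> nat \<Rightarrow> nat \<times> nat \<Rightarrow> nat \<times> nat" where
  "par v w = (fst v * snd w + snd v * fst w, snd v * snd w)"

definition ser :: "nat \<times> nat \<Rightarrow> nat \<times> nat \<Rightarrow> nat \<times> nat" where
  "ser v w = (fst v * fst w, fst v * snd w + snd v * fst w)"

abbreviation pgadget :: "nat \<Rightarrow> bool \<Rightarrow> nat \<Rightarrow> nat \<Rightarrow> nat \<Rightarrow> nat \<times> nat \<Rightarrow> bool" where
  "pgadget k a d1 d2 s v \<equiv> gadget k a d1 d2 s (fst v) (snd v)"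

lemma pgadget_par:
  "pgadget k False d1 d2 s v \<Longrightarrow> pgadget k False d1' d2' s' w \<Longrightarrow>
    pgadget k False (d1 + d1') (d2 + d2') (s + s') (par v w)"
  unfolding par_def by (simp add: gadget_parallel)

lemma pgadget_ser:
  "pgadget k a d1 d s v \<Longrightarrow> pgadget k b d' d2 s' w \<Longrightarrow> d + d' = k \<Longrightarrow>
    pgadget k False d1 d2 (Suc (s + s')) (ser v w)"
  using gadget_series[of k a d1 d s _ _ b d' d2 s'] unfolding ser_def by simp

lemma pgadget_edge: "pgadget k True 1 1 0 (1, 1)"
  using gadget_edge[of k] by simp

definition pendant :: "nat \<times> nat \<Rightarrow> nat \<times> nat" where
  "pendant v = ser (ser (1, 1) v) (1, 1)"

text \<open>Two unit resistors in series: \<open>F / T\<close> grows by 2 while \<open>T\<close> is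
  kept.\<close>

lemma pendant_eq: "pendant v = (fst v, snd v + 2 * fst v)"
  by (simp add: pendant_def ser_def)

lemma pgadget_pendant:
  assumes "pgadget k False (k - 1) (k - 1) s v" "k \<ge> 3"
  shows "pgadget k False 1 1 (s + 2) (pendant v)"
proof -
  have "pgadget k False 1 (k - 1) (Suc (0 + s)) (ser (1, 1) v)"
    using assms by (intro pgadget_ser[OF pgadget_edge]) auto
  then have "pgadget k False 1 1 (Suc (Suc (0 + s) + 0)) (pendant v)"
    unfolding pendant_def using assms by (intro pgadget_ser[OF _ pgadget_edge]) auto
  then show ?thesis by simp
qed

text \<open>Each parallel copy raises both terminal degrees by 1, so \<open>k - 2\<close> copies
  lift them from 1 to \<open>k - 1\<close>.\<close>

definition shunt :: "nat \<Rightarrow> nat \<times> nat \<Rightarrow> nat \<times> nat \<Rightarrow> nat \<times> nat" where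
  "shunt k N v = ((\<lambda>v. par v (pendant N)) ^^ (k - 2)) v"

definition letter0 :: "nat \<Rightarrow> nat \<times> nat \<Rightarrow> nat \<times> nat \<Rightarrow> nat \<times> nat" where
  "letter0 k N v = pendant (shunt k N v)"

text \<open>Alternating \<open>N\<close> with single edges gives every junction degree
  \<open>(k - 1) + 1 = k\<close>. The tail adds \<open>2 * R + 2\<close> to the resistance, where
  \<open>R\<close> is that of \<open>N\<close>.\<close>

definition letter1 :: "nat \<Rightarrow> nat \<times> nat \<Rightarrow> nat \<times> nat \<Rightarrow> nat \<times> nat" where
  "letter1 k N v = ser (ser (ser (ser (letter0 k N v) N) (1, 1)) N) (1, 1)"

text \<open>Both blocks use each letter once, so they add the same number of vertices.\<close>

definition block :: "nat \<Rightarrow> nat \<times> nat \<Rightarrow> bool \<Rightarrow> nat \<times> nat \<Rightarrow> nat \<times> nat" where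
  "block k N b v = (if b then letter0 k N (letter1 k N v) else letter1 k N (letter0 k N v))"

text \<open>A copy of \<open>pendant N\<close> contributes \<open>k + 1\<close> inner vertices, and
  the outer \<open>pendant\<close> of each letter turns two terminals into inner vertices. The last
  summand is the tail of \<open>letter1\<close>.\<close>

definition block_size :: "nat \<Rightarrow> nat" where
  "block_size k = 2 * ((k - 2) * (k + 1) + 2) + 2 * (k + 1)"

context
  fixes k :: nat and N :: "nat \<times> nat"
  assumes k: "k \<ge> 3" and N: "pgadget k False (k - 1) (k - 1) (k - 1) N" and N_pos: "fst N > 0"
begin

section \<open>Degrees and sizes of words\<close>

lemma pgadget_pendant_N: "pgadget k False 1 1 (k + 1) (pendant N)"
  using pgadget_pendant[OF N k] k by simp

lemma pgadget_shunt:
  assumes "pgadget k False 1 1 s v"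
  shows "pgadget k False (k - 1) (k - 1) (s + (k - 2) * (k + 1)) (shunt k N v)"
proof -
  have "pgadget k False (1 + j) (1 + j) (s + j * (k + 1)) (((\<lambda>v. par v (pendant N)) ^^ j) v)" for j
  proof (induction j)
    case (Suc j)
    from pgadget_par[OF Suc.IH pgadget_pendant_N] show ?case by (simp add: algebra_simps)
  qed (use assms in simp)
  from this[of "k - 2"] show ?thesis unfolding shunt_def using k by (simp add: Suc_diff_Suc numeral_2_eq_2)
qed

lemma pgadget_letter0:
  assumes "pgadget k False 1 1 s v"
  shows "pgadget k False 1 1 (s + ((k - 2) * (k + 1) + 2)) (letter0 k N v)"
  using pgadget_pendant[OF pgadget_shunt[OF assms] k] by (simp add: letter0_def add.assoc)

lemma pgadget_ser_N_edge:
  assumes "pgadget k False 1 1 s v"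
  shows "pgadget k False 1 1 (s + (k + 1)) (ser (ser v N) (1, 1))"
proof -
  have "pgadget k False 1 (k - 1) (Suc (s + (k - 1))) (ser v N)"
    using k by (intro pgadget_ser[OF assms N]) auto
  then have "pgadget k False 1 1 (Suc (Suc (s + (k - 1)) + 0)) (ser (ser v N) (1, 1))"
    using k by (intro pgadget_ser[OF _ pgadget_edge]) auto
  moreover have "Suc (Suc (s + (k - 1)) + 0) = s + (k + 1)" using k by simp
  ultimately show ?thesis by simp
qed

lemma pgadget_letter1:
  assumes "pgadget k False 1 1 s v"
  shows "pgadget k False 1 1 (s + ((k - 2) * (k + 1) + 2) + 2 * (k + 1)) (letter1 k N v)"
  using pgadget_ser_N_edge[OF pgadget_ser_N_edge[OF pgadget_letter0[OF assms]]]
  by (simp add: letter1_def mult_2 add.assoc)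

lemma pgadget_block:
  assumes "pgadget k False 1 1 s v"
  shows "pgadget k False 1 1 (s + block_size k) (block k N b v)"
  using pgadget_letter0[OF pgadget_letter1[OF assms]] pgadget_letter1[OF pgadget_letter0[OF assms]]
  by (cases b) (simp_all add: block_def block_size_def algebra_simps)

lemma pgadget_word:
  assumes "pgadget k False 1 1 s v"
  shows "pgadget k False 1 1 (s + length bs * block_size k) (foldr (block k N) bs v)"
proof (induction bs)
  case (Cons b bs)
  from pgadget_block[OF Cons.IH] show ?case by (simp add: algebra_simps)
qed (use assms in simp)

section \<open>Injectivity of the letters\<close>

lemma inj_par_pendant: "inj (\<lambda>v. par v (pendant N))"
proof (rule injI)
  fix v w assume eq: "par v (pendant N) = par w (pendant N)"
  \<comment> \<open>The map is triangular in \<open>(T, F)\<close>; both diagonal entries are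
    \<open>snd (pendant N)\<close>, which is at least \<open>2 * fst N\<close>.\<close>
  then have "snd v = snd w" using N_pos by (simp add: par_def pendant_eq)
  then show "v = w" using eq N_pos by (simp add: par_def pendant_eq prod_eq_iff)
qed

lemma inj_pendant: "inj pendant"
  by (rule injI) (auto simp: pendant_eq prod_eq_iff)

lemma inj_shunt: "inj (shunt k N)"
  using inj_fn[OF inj_par_pendant] by (simp add: shunt_def[abs_def])

lemma inj_letter0: "inj (letter0 k N)"
  using inj_compose[OF inj_pendant inj_shunt] by (simp add: letter0_def[abs_def] comp_def)

text \<open>The map is triangular with both diagonal entries equal to \<open>fst w\<close>.\<close>

lemma inj_ser_left:
  assumes "fst w > 0"
  shows "inj (\<lambda>v. ser v w)"
proof (rule injI)
  fix v v' assume eq: "ser v w = ser v' w"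
  then have "fst v = fst v'" using assms by (simp add: ser_def)
  then show "v = v'" using eq assms by (simp add: ser_def prod_eq_iff)
qed

lemma inj_letter1: "inj (letter1 k N)"
proof (rule injI)
  fix v w assume "letter1 k N v = letter1 k N w"
  then have "letter0 k N v = letter0 k N w"
    unfolding letter1_def by (auto dest!: injD[OF inj_ser_left[of "(1, 1)"], simplified]
      injD[OF inj_ser_left[OF N_pos]])
  then show "v = w" by (rule injD[OF inj_letter0])
qed

section \<open>Separation of the letters by effective resistance\<close>

lemma shunt_last: "\<exists>w. (fst v > 0 \<longrightarrow> fst w > 0) \<and> shunt k N v = par w (pendant N)"
proof -
  have pos: "fst v > 0 \<longrightarrow> fst (((\<lambda>v. par v (pendant N)) ^^ j) v) > 0" for j
    using N_pos by (induction j) (auto simp: par_def pendant_eq)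
  \<comment> \<open>Since \<open>k \<ge> 3\<close>, there is a last parallel copy to split
    off.\<close>
  obtain j where j: "k - 2 = Suc j" using k by (metis Suc_diff_Suc numeral_2_eq_2 numeral_3_eq_3 Suc_le_lessD)
  show ?thesis
    unfolding shunt_def j using pos[of j] by (intro exI[of _ "((\<lambda>v. par v (pendant N)) ^^ j) v"]) simp
qed

text \<open>
  With \<open>R = F/T\<close> the effective resistance between the terminals, \<open>letter0\<close> produces only values
  below \<open>4 + R N\<close>, since the parallel copy of \<open>pendant N\<close> bounds the inner part by \<open>R N + 2\<close>,
  whereas \<open>letter1\<close> produces only values from \<open>4 + 2 R N\<close> on.
\<close>

lemma letter0_low:
  assumes "fst v > 0"
  shows "snd (letter0 k N v) * fst N < fst (letter0 k N v) * (snd N + 4 * fst N)"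
    "fst (letter0 k N v) > 0"
proof -
  obtain w where w: "fst w > 0" "shunt k N v = par w (pendant N)" using shunt_last[of v] assms by auto
  \<comment> \<open>This product is exactly the difference between the two sides of the
    claim.\<close>
  have "fst w * ((snd N + 2 * fst N) * (snd N + 2 * fst N)) > 0" using w(1) N_pos by simp
  then show "snd (letter0 k N v) * fst N < fst (letter0 k N v) * (snd N + 4 * fst N)"
    by (simp add: letter0_def w(2) pendant_eq par_def algebra_simps)
  show "fst (letter0 k N v) > 0" using w N_pos by (simp add: letter0_def w(2) pendant_eq par_def)
qed

lemma letter1_high:
  assumes "fst v > 0"
  shows "fst (letter1 k N v) * (snd N + 4 * fst N) \<le> snd (letter1 k N v) * fst N"
    "fst (letter1 k N v) > 0"
proof -
  obtain T F where TF: "letter0 k N v = (T, F)" by (rule prod.exhaust)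
  have "T > 0" using letter0_low(2)[OF assms] TF by simp
  \<comment> \<open>The outer \<open>pendant\<close> of \<open>letter0\<close> already contributes
    resistance 2.\<close>
  have F: "2 * T \<le> F" using TF by (auto simp: letter0_def pendant_eq)
  let ?t = "fst N"
  \<comment> \<open>This is what remains of the claim after expansion and cancellation.\<close>
  have "T * (?t * (?t * (?t * 2))) \<le> F * (?t * (?t * ?t)) + T * (?t * (?t * snd N))"
    using mult_right_mono[OF F, of "?t * (?t * ?t)"] by (intro trans_le_add1) (simp add: algebra_simps)
  then show "fst (letter1 k N v) * (snd N + 4 * fst N) \<le> snd (letter1 k N v) * fst N"
    by (simp add: letter1_def TF ser_def algebra_simps)
  show "fst (letter1 k N v) > 0" using \<open>T > 0\<close> N_pos by (simp add: letter1_def TF ser_def)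
qed

lemma block_pos: "fst v > 0 \<Longrightarrow> fst (block k N b v) > 0"
  by (simp add: block_def letter0_low(2) letter1_high(2))

text \<open>Every block ends with an edge in series, so its resistance is at least 1. This later
  makes the forest counts of the closings positive.\<close>

lemma block_fst_le_snd: "fst (block k N b v) \<le> snd (block k N b v)"
proof -
  have "fst (ser w (1, 1)) \<le> snd (ser w (1, 1))" for w by (simp add: ser_def)
  then show ?thesis by (simp add: block_def letter1_def letter0_def[of k N "ser _ _"] pendant_def)
qed

lemma word_pos: "fst v > 0 \<Longrightarrow> fst (foldr (block k N) bs v) > 0"
  by (induction bs) (simp_all add: block_pos)

text \<open>The resistance shows which letter is outermost, hence the bit; injectivity of both
  letters then recovers the argument.\<close>

lemma block_inject:
  assumes "fst v > 0" "fst w > 0" "block k N b v = block k N c w"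
  shows "b = c \<and> v = w"
proof -
  have ne: "letter0 k N x \<noteq> letter1 k N y" if "fst x > 0" "fst y > 0" for x y
    using letter0_low(1)[OF that(1)] letter1_high(1)[OF that(2)] by auto
  have pos: "fst (letter1 k N x) > 0" "fst (letter0 k N x) > 0" if "fst x > 0" for x
    using that letter0_low(2) letter1_high(2) by auto
  have "b = c"
    using assms ne[OF pos(1)[OF assms(1)] pos(2)[OF assms(2)]] ne[OF pos(1)[OF assms(2)] pos(2)[OF assms(1)]]
    by (cases b; cases c) (auto simp: block_def)
  then show ?thesis
    using assms(3) by (cases b) (simp_all add: block_def inj_eq[OF inj_letter0] inj_eq[OF inj_letter1])
qed

lemma word_inject:
  assumes "fst v > 0"
  shows "length bs = length cs \<Longrightarrow> foldr (block k N) bs v = foldr (block k N) cs v \<Longrightarrow> bs = cs"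
proof (induction bs cs rule: list_induct2)
  case (Cons b bs c cs)
  then show ?case using block_inject[OF word_pos[OF assms] word_pos[OF assms]] by auto
qed simp

section \<open>Closing a word to a regular graph\<close>

definition closing :: "bool \<Rightarrow> nat \<times> nat" where
  "closing b = block k N b (pendant N)"

text \<open>The size does not depend on \<open>b\<close>, and terminal degree 1 complements the
  \<open>k - 1\<close> left by \<open>shunt\<close>.\<close>

lemma pgadget_closing: "pgadget k False 1 1 (k + 1 + block_size k) (closing b)"
  unfolding closing_def by (rule pgadget_block[OF pgadget_pendant_N])

text \<open>The resistances \<open>F / T\<close> of the two closings, cross-multiplied: the
  outermost letters are \<open>letter0\<close> and \<open>letter1\<close>, so the threshold
  \<open>?r / fst N\<close> lies between them.\<close>

lemma closing_cross: "snd (closing True) * fst (closing False) < snd (closing False) * fst (closing True)"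
proof -
  have P: "fst (pendant N) > 0" using N_pos by (simp add: pendant_eq)
  let ?r = "snd N + 4 * fst N"
  have lo: "snd (closing True) * fst N < fst (closing True) * ?r"
    unfolding closing_def block_def using letter0_low(1)[OF letter1_high(2)[OF P]] by simp
  have hi: "fst (closing False) * ?r \<le> snd (closing False) * fst N" "fst (closing False) > 0"
    unfolding closing_def block_def using letter1_high[OF letter0_low(2)[OF P]] by simp_all
  have "(snd (closing True) * fst (closing False)) * fst N = (snd (closing True) * fst N) * fst (closing False)"
    by simp
  also have "\<dots> < (fst (closing True) * ?r) * fst (closing False)"
    using lo hi(2) by simp
  also have "\<dots> = fst (closing True) * (fst (closing False) * ?r)" by simp
  also have "\<dots> \<le> fst (closing True) * (snd (closing False) * fst N)"
    using hi(1) by (rule mult_left_mono) simp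
  also have "\<dots> = (snd (closing False) * fst (closing True)) * fst N" by simp
  finally show ?thesis by simp
qed

text \<open>The two tree counts are linear forms in \<open>(T, F)\<close> whose determinant is
  nonzero by \<open>closing_cross\<close>.\<close>

lemma closings_determine_vector:
  assumes "\<And>b. fst (par v (closing b)) = fst (par w (closing b))"
  shows "v = w"
proof -
  define a b where "a = int (fst v) - int (fst w)" and "b = int (snd v) - int (snd w)"
  define T0 F0 T1 F1 where "T0 = int (fst (closing True))" and "F0 = int (snd (closing True))"
    and "T1 = int (fst (closing False))" and "F1 = int (snd (closing False))"
  have e: "a * F0 + b * T0 = 0" "a * F1 + b * T1 = 0"
    using assms[of True, THEN arg_cong[where f = int]] assms[of False, THEN arg_cong[where f = int]]
    by (simp_all add: par_def a_def b_def T0_def F0_def T1_def F1_def algebra_simps)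
  have lt: "F0 * T1 < F1 * T0"
    using closing_cross unfolding T0_def F0_def T1_def F1_def by (metis of_nat_less_iff of_nat_mult)
  \<comment> \<open>Cramer's rule, over the integers to allow differences.\<close>
  have "a * (F0 * T1 - F1 * T0) = (a * F0 + b * T0) * T1 - (a * F1 + b * T1) * T0"
    by (simp add: algebra_simps)
  then have a0: "a = 0" using e lt by simp
  have "0 \<le> F0 * T1" by (simp add: F0_def T1_def)
  then have "T0 \<noteq> 0" using lt by auto
  then have "b = 0" using e a0 by simp
  then show "v = w" using a0 by (simp add: a_def b_def prod_eq_iff)
qed

lemma regular_graph_of_word:
  assumes "pgadget k False 1 1 s v" "fst v > 0"
  shows "\<exists>G :: nat pair_pre_digraph. regular_graph k G \<and> Digraph_Component.connected (with_proj G) \<and>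
    card (pverts G) = s + length bs * block_size k + ((k - 1) * (k + 1) + block_size k + 2) \<and>
    num_spanning_trees G = fst (par (shunt k N (foldr (block k N) bs v)) (closing b))"
proof -
  let ?v = "foldr (block k N) bs v"
  have "pgadget k False (k - 1 + 1) (k - 1 + 1)
      (s + length bs * block_size k + (k - 2) * (k + 1) + (k + 1 + block_size k)) (par (shunt k N ?v) (closing b))"
    by (rule pgadget_par[OF pgadget_shunt[OF pgadget_word[OF assms(1)]] pgadget_closing])
  moreover have "fst (par (shunt k N ?v) (closing b)) > 0"
  proof -
    \<comment> \<open>\<open>pendant\<close> keeps the tree count, so \<open>shunt\<close> inherits
      positivity from \<open>letter0\<close>.\<close>
    have "fst (shunt k N ?v) > 0"
      using letter0_low(2)[OF word_pos[OF assms(2)], of bs] by (simp add: letter0_def pendant_eq)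
    moreover have "snd (closing b) > 0"
      using block_pos[of "pendant N" b] block_fst_le_snd[of b "pendant N"] N_pos
      by (simp add: closing_def pendant_eq)
    ultimately show ?thesis by (simp add: par_def)
  qed
  ultimately have "\<exists>G :: nat pair_pre_digraph. regular_graph k G \<and> Digraph_Component.connected (with_proj G) \<and>
      card (pverts G) = s + length bs * block_size k + (k - 2) * (k + 1) + (k + 1 + block_size k) + 2 \<and>
      num_spanning_trees G = fst (par (shunt k N ?v) (closing b))"
    using k by (intro gadget_imp_regular_graph) simp_all
  moreover have "s + length bs * block_size k + (k - 2) * (k + 1) + (k + 1 + block_size k) + 2 =
      s + length bs * block_size k + ((k - 1) * (k + 1) + block_size k + 2)"
  proof -
    have "k - 1 = Suc (k - 2)" using k by simp
    then show ?thesis by simp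
  qed
  ultimately show ?thesis by (simp only:)
qed

end

section \<open>Choice of parameters and the final count\<close>

theorem theorem1p2:
  fixes k :: nat
  assumes "k \<ge> 3"
  shows "\<exists>c::real. c > 0 \<and> (\<exists>n0::nat. \<forall>n::nat. n \<ge> n0 \<and> even (k * n) \<longrightarrow>
           real (card {num_spanning_trees G | G :: nat pair_pre_digraph.
                         regular_graph k G \<and> Digraph_Component.connected (with_proj G) \<and>
                         card (pverts G) = n})
             \<ge> 2 powr (c * real n))"
proof -
  \<comment> \<open>The circulant behind \<open>N\<close> is the complete graph on
    \<open>k + 1\<close> vertices, the smallest order that \<open>base_gadget_exists\<close>
    admits.\<close>
  obtain t f where "t > 0" "gadget k False (k - 1) (k - 1) (k + 1 - 2) t f"
    using base_gadget_exists[of k "k + 1"] assms by auto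
  then obtain N where N: "pgadget k False (k - 1) (k - 1) (k - 1) N" "fst N > 0"
    by (metis fst_conv snd_conv diff_add_inverse2 diff_diff_left one_add_one)
  define q where "q = block_size k"
  \<comment> \<open>The overhead in \<open>regular_graph_of_word\<close>: last shunt, closing and
    both terminals.\<close>
  define r where "r = (k - 1) * (k + 1) + q + 2"
  have q: "q > 0" "even q" by (auto simp: q_def block_size_def)
  \<comment> \<open>As \<open>q\<close> is even too, \<open>k * s\<close> inherits its parity from
    \<open>k * n\<close>.\<close>
  have even_r: "even (k * r)" using q by (cases "even k") (auto simp: r_def)
  \<comment> \<open>Half of \<open>n\<close> goes to at least \<open>n / (2 * q)\<close> blocks, and
    passing from pairs of counts to single counts halves the exponent.\<close>
  have bound: "2 powr (1 / (4 * real q) * real n) \<le>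
      real (card {num_spanning_trees G | G :: nat pair_pre_digraph.
        regular_graph k G \<and> Digraph_Component.connected (with_proj G) \<and> card (pverts G) = n})"
    (is "_ \<le> real (card ?X)") if n: "n \<ge> 2 * (r + (k + 1) + q)" "even (k * n)" for n
  proof -
    \<comment> \<open>The innermost graph absorbs the remainder modulo \<open>q\<close>; its order
      \<open>s\<close> stays above \<open>k\<close>, as the circulant requires, and is at most
      \<open>k + q\<close>.\<close>
    define m where "m = (n - r - (k + 1)) div q"
    define s where "s = k + 1 + (n - r - (k + 1)) mod q"
    have split: "n = s + m * q + r"
    proof -
      have "n = n - r - (k + 1) + (k + 1) + r" using n(1) by simp
      then show ?thesis
        using div_mult_mod_eq[of "n - r - (k + 1)" q] unfolding m_def s_def by linarith
    qed
    have "even (k * s)" using n(2) q even_r unfolding split by (simp add: algebra_simps)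
    then obtain t' f' where "t' > 0" "gadget k False (k - 1) (k - 1) (s - 2) t' f'"
      using base_gadget_exists[of k s] assms unfolding s_def by auto
    \<comment> \<open>\<open>pendant\<close> makes the two terminals inner vertices, restoring
      \<open>s - 2\<close> to \<open>s\<close>.\<close>
    then have v: "pgadget k False 1 1 s (pendant (t', f'))" "fst (pendant (t', f')) > 0"
      using pgadget_pendant[of k "s - 2" "(t', f')"] assms by (simp_all add: pendant_eq s_def)
    define \<tau> where "\<tau> bs b = fst (par (shunt k N (foldr (block k N) bs (pendant (t', f')))) (closing k N b))" for bs b
    let ?L = "{bs :: bool list. length bs = m}"
    have mem: "\<tau> bs b \<in> ?X" if "bs \<in> ?L" for bs b
      using regular_graph_of_word[OF assms N v, of bs b] that
      unfolding \<tau>_def split r_def q_def by force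
    \<comment> \<open>The pair of counts determines the vector before closing, which in turn
      determines the word.\<close>
    have "inj_on (\<lambda>bs. (\<tau> bs True, \<tau> bs False)) ?L"
    proof (rule inj_onI)
      fix bs cs assume L: "bs \<in> ?L" "cs \<in> ?L" and eq: "(\<tau> bs True, \<tau> bs False) = (\<tau> cs True, \<tau> cs False)"
      have "\<tau> bs b = \<tau> cs b" for b using eq by (cases b) auto
      then have "shunt k N (foldr (block k N) bs (pendant (t', f'))) =
          shunt k N (foldr (block k N) cs (pendant (t', f')))"
        unfolding \<tau>_def by (rule closings_determine_vector[OF assms N])
      then have "foldr (block k N) bs (pendant (t', f')) = foldr (block k N) cs (pendant (t', f'))"
        by (rule injD[OF inj_shunt[OF assms N]])
      then show "bs = cs" using L by (intro word_inject[OF assms N v(2)]) auto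
    qed
    moreover have "(\<lambda>bs. (\<tau> bs True, \<tau> bs False)) ` ?L \<subseteq> ?X \<times> ?X" using mem by blast
    moreover have "finite (?X \<times> ?X)" using finite_num_spanning_trees_values by blast
    ultimately have "card ?L \<le> card (?X \<times> ?X)" by (rule card_inj_on_le)
    moreover have "card ?L = 2 ^ m"
      using card_lists_length_eq[of "UNIV :: bool set" m] by simp
    ultimately have "2 ^ m \<le> card ?X * card ?X" by (simp add: card_cartesian_product)
    then have "real (2 ^ m) \<le> real (card ?X * card ?X)" by (rule of_nat_mono)
    then have sq: "2 ^ m \<le> (real (card ?X))\<^sup>2"
      unfolding power2_eq_square of_nat_mult of_nat_power of_nat_numeral .
    have "n \<le> 2 * (m * q)"
    proof -
      have "s \<le> k + 1 + q" using q unfolding s_def by (simp add: less_imp_le)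
      then have "2 * (s + r) \<le> n" using n(1) by simp
      moreover have "2 * n = 2 * (s + r) + 2 * (m * q)" by (subst split) simp
      ultimately show ?thesis by linarith
    qed
    then have "real n \<le> real (2 * (m * q))" by (rule of_nat_mono)
    then have "1 / (4 * real q) * real n \<le> real m / 2" using q by (simp add: field_simps)
    then have "2 powr (1 / (4 * real q) * real n) \<le> 2 powr (real m / 2)" by simp
    also have "\<dots> \<le> real (card ?X)"
    proof (rule power2_le_imp_le)
      have "(2 powr (real m / 2))\<^sup>2 = (2::real) powr real m"
        by (simp add: power2_eq_square flip: powr_add)
      then show "(2 powr (real m / 2))\<^sup>2 \<le> (real (card ?X))\<^sup>2" using sq by (simp add: powr_realpow)
    qed simp
    finally show ?thesis .
  qed
  show ?thesis
  proof (rule exI[of _ "1 / (4 * real q)"], intro conjI exI[of _ "2 * (r + (k + 1) + q)"] allI impI)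
    show "0 < 1 / (4 * real q)" using q(1) by simp
  next
    fix n assume "n \<ge> 2 * (r + (k + 1) + q) \<and> even (k * n)"
    then show "2 powr (1 / (4 * real q) * real n) \<le>
      real (card {num_spanning_trees G | G :: nat pair_pre_digraph.
        regular_graph k G \<and> Digraph_Component.connected (with_proj G) \<and> card (pverts G) = n})"
      by (elim conjE) (rule bound)
  qed
qed

end
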